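(* Let $Q$ be the set of prime powers, and for $q\in Q$ let $G_q$ be the incidence graph of the projective plane $PG(2,q)$. Then the sequence $(G_q)_{q\in Q}$ (with $q$ ranging over $Q$ in increasing order) is log-convergent. Moreover, its limit is $R(3/4,1/2)$, that is, for every $H\in\mathcal B_0$, $$\lim_{q\to\infty,\ q\in Q} h(H,G_q)=R(3/4,1/2,H).$$
   Context: Let $\mathcal B$ be the set of finite bipartite graphs with labelled vertex classes, $G=(V_1(G),V_2(G),E(G))$ with $E(G)\subseteq V_1(G)\times V_2(G)$; $\mathcal B_0\subseteq\mathcal B$ is the set of those with at least one edge. Homomorphisms between elements of $\mathcal B$ are graph homomorphisms $\varphi:H\to G$ that are label-preserving, i.e. $\varphi(V_i(H))\subseteq V_i(G)$ for $i=1,2$; $\mathrm{hom}(H,G)$ is the number of homomorphisms from $H$ to $G$. Put $$t_B(H,G)=\frac{\mathrm{hom}(H,G)}{|V_1(G)|^{|V_1(H)|}|V_2(G)|^{|V_2(H)|}}.$$ $K_2\in\mathcal B_0$ is the single edge (one vertex in each class), and $$h(H,G)=\frac{-\log t_B(H,G)}{-\log t_B(K_2,G)},$$ with $h(H,G):=|E(H)|$ if $G$ is a complete bipartite graph. A sequence $(G_n)_n$ in $\mathcal B_0$ is log-convergent if for every $H_1,H_2\in\mathcal B_0$ the sequence $\left(\frac{-\log t_B(H_1,G_n)}{-\log t_B(H_2,G_n)}\right)_n$ of real numbers has a limit; equivalently, if $\lim_n h(H,G_n)$ exists for every $H\in\mathcal B_0$. The limit of a log-convergent sequence is the vector $(\lim_n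 h(H,G_n))_{H\in\mathcal B_0}\in\mathbb R_{\ge 0}^{\mathcal B_0}$. $PG(2,q)$ is the projective plane over $\mathbb F_q$ (points are the 1-dimensional subspaces and lines the 2-dimensional subspaces of $\mathbb F_q^3$). Its incidence graph $G_q\in\mathcal B_0$ has $V_1$ the set of points, $V_2$ the set of lines, and an edge between a point $p$ and a line $\ell$ iff $p\in\ell$. A collapse of a graph $H\in\mathcal B$ is a graph $H'\in\mathcal B$ for which there is a (label-preserving) homomorphism $H\to H'$ that is surjective on vertices and on edges. $\mathcal C(H)$ is the set of collapses of $H$ (up to isomorphism). For $\beta,\alpha\in(0,1)$, $R(\beta,\alpha)=(R(\beta,\alpha,H))_{H\in\mathcal B_0}$, where $$R(\beta,\alpha,H)=\min_{H'\in\mathcal C(H)}\left\{|E(H')|+\frac{\alpha}{1-\beta}\left(|V_1(H)|-|V_1(H')|\right)+\frac{1-\alpha}{1-\beta}\left(|V_2(H)|-|V_2(H')|\right)\right\}.$$ (By a theorem of Szegedy, this is the limit, with probability 1, of random bipartite graphs with $|V_1|=\lceil n^{\alpha}\rceil$, $|V_2|=\lceil n^{1-\alpha}\rceil$ and each edge included independently with probability $n^{\beta-1}$.) *)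

theory Defs
  imports
    Complex_Main
    "HOL-Library.FuncSet"
    "HOL-Library.Infinite_Set"
    "HOL-Number_Theory.Prime_Powers"
    "Jordan_Normal_Form.Missing_VectorSpace"
begin

section \<open>Bipartite graphs with labelled vertex classes\<close>

text \<open>The two classes live in separate types, so they are disjoint by construction.\<close>

datatype ('a, 'b) bigraph =
  Bigraph (verts1: "'a set") (verts2: "'b set") (edges: "('a \<times> 'b) set")

definition bigraphs :: "('a, 'b) bigraph set" where
  "bigraphs = {G. finite (verts1 G) \<and> finite (verts2 G) \<and> edges G \<subseteq> verts1 G \<times> verts2 G}"

definition bigraphs0 :: "('a, 'b) bigraph set" where
  "bigraphs0 = {G \<in> bigraphs. edges G \<noteq> {}}"

definition complete_bipartite :: "('a, 'b) bigraph \<Rightarrow> bool" where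
  "complete_bipartite G \<longleftrightarrow> edges G = verts1 G \<times> verts2 G"

definition K2 :: "(nat, nat) bigraph" where
  "K2 = Bigraph {0} {0} {(0, 0)}"

text \<open>A label-preserving homomorphism is given by its restrictions to the two classes. These are
  extensional functions, so that distinct pairs are distinct maps on the vertices.\<close>

definition homs :: "('a, 'b) bigraph \<Rightarrow> ('c, 'd) bigraph \<Rightarrow> (('a \<Rightarrow> 'c) \<times> ('b \<Rightarrow> 'd)) set" where
  "homs H G = {(f, g). f \<in> verts1 H \<rightarrow>\<^sub>E verts1 G \<and> g \<in> verts2 H \<rightarrow>\<^sub>E verts2 G \<and>
     (\<forall>(u, v) \<in> edges H. (f u, g v) \<in> edges G)}"

definition hom_count :: "('a, 'b) bigraph \<Rightarrow> ('c, 'd) bigraph \<Rightarrow> nat" where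
  "hom_count H G = card (homs H G)"

definition t_B :: "('a, 'b) bigraph \<Rightarrow> ('c, 'd) bigraph \<Rightarrow> real" where
  "t_B H G = real (hom_count H G) /
     (real (card (verts1 G)) ^ card (verts1 H) * real (card (verts2 G)) ^ card (verts2 H))"


section \<open>Logarithmic convergence\<close>

definition h_B :: "('a, 'b) bigraph \<Rightarrow> ('c, 'd) bigraph \<Rightarrow> real" where
  "h_B H G = (if complete_bipartite G then real (card (edges H))
              else (- ln (t_B H G)) / (- ln (t_B K2 G)))"

text \<open>For complete bipartite \<open>G\<close> the quotient of logarithms is \<open>0 / 0\<close>; the value used
  instead is the one forced by the convention for \<^const>\<open>h_B\<close>, so that
  \<open>log_ratio H\<^sub>1 H\<^sub>2 G = h_B H\<^sub>1 G / h_B H\<^sub>2 G\<close> for all graphs in \<^const>\<open>bigraphs0\<close>.\<close>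

definition log_ratio ::
  "('a, 'b) bigraph \<Rightarrow> ('e, 'f) bigraph \<Rightarrow> ('c, 'd) bigraph \<Rightarrow> real" where
  "log_ratio H1 H2 G = (if complete_bipartite G then real (card (edges H1)) / real (card (edges H2))
                        else (- ln (t_B H1 G)) / (- ln (t_B H2 G)))"

text \<open>Test graphs with vertices in \<^typ>\<open>nat\<close> suffice: every finite bipartite graph is isomorphic to
  one of them, and \<^const>\<open>t_B\<close> depends only on the isomorphism class.\<close>

definition log_convergent :: "(nat \<Rightarrow> ('c, 'd) bigraph) \<Rightarrow> bool" where
  "log_convergent G \<longleftrightarrow> (\<forall>n. G n \<in> bigraphs0) \<and>
     (\<forall>H1 \<in> (bigraphs0 :: (nat, nat) bigraph set). \<forall>H2 \<in> (bigraphs0 :: (nat, nat) bigraph set).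
        convergent (\<lambda>n. log_ratio H1 H2 (G n)))"


section \<open>Collapses\<close>

text \<open>A collapse of \<open>H\<close> has no more vertices in either class than \<open>H\<close>, so up to isomorphism every
  collapse occurs with vertices in the types of those of \<open>H\<close>.\<close>

definition collapses :: "('a, 'b) bigraph \<Rightarrow> ('a, 'b) bigraph set" where
  "collapses H = {H' \<in> bigraphs. \<exists>(f, g) \<in> homs H H'.
     f ` verts1 H = verts1 H' \<and> g ` verts2 H = verts2 H' \<and> map_prod f g ` edges H = edges H'}"

definition collapse_weight ::
  "real \<Rightarrow> real \<Rightarrow> ('a, 'b) bigraph \<Rightarrow> ('a, 'b) bigraph \<Rightarrow> real" where
  "collapse_weight \<beta> \<alpha> H H' = real (card (edges H'))
     + \<alpha> / (1 - \<beta>) * (real (card (verts1 H)) - real (card (verts1 H')))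
     + (1 - \<alpha>) / (1 - \<beta>) * (real (card (verts2 H)) - real (card (verts2 H')))"

definition R_lim :: "real \<Rightarrow> real \<Rightarrow> ('a, 'b) bigraph \<Rightarrow> real" where
  "R_lim \<beta> \<alpha> H = Min (collapse_weight \<beta> \<alpha> H ` collapses H)"

lemma self_in_collapses:
  assumes "H \<in> bigraphs"
  shows "H \<in> collapses H"
proof -
  define f where "f = restrict id (verts1 H)"
  define g where "g = restrict id (verts2 H)"
  have sub: "edges H \<subseteq> verts1 H \<times> verts2 H"
    using assms by (simp add: bigraphs_def)
  have fg: "map_prod f g e = e" if "e \<in> edges H" for e
    using that sub by (auto simp: f_def g_def)
  have "map_prod f g ` edges H = edges H"
    using fg by force
  moreover have "(f, g) \<in> homs H H"
    using fg sub by (auto simp: homs_def f_def g_def)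
  moreover have "f ` verts1 H = verts1 H" "g ` verts2 H = verts2 H"
    by (auto simp: f_def g_def)
  ultimately show ?thesis
    using assms unfolding collapses_def by blast
qed

text \<open>The set of collapses may be infinite, but only finitely many weights occur, so the minimum is
  well defined and attained.\<close>

lemma finite_collapse_weights:
  assumes "H \<in> bigraphs"
  shows "finite (collapse_weight \<beta> \<alpha> H ` collapses H)"
proof -
  let ?w = "\<lambda>(e, m, n). real e + \<alpha> / (1 - \<beta>) * (real (card (verts1 H)) - real m)
     + (1 - \<alpha>) / (1 - \<beta>) * (real (card (verts2 H)) - real n)"
  let ?I = "{..card (edges H)} \<times> {..card (verts1 H)} \<times> {..card (verts2 H)}"
  have fin: "finite (verts1 H)" "finite (verts2 H)" "finite (edges H)"
    using assms by (auto simp: bigraphs_def intro: finite_subset)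
  have "collapse_weight \<beta> \<alpha> H H' \<in> ?w ` ?I" if "H' \<in> collapses H" for H'
  proof -
    obtain f g where fg: "f ` verts1 H = verts1 H'" "g ` verts2 H = verts2 H'"
      "map_prod f g ` edges H = edges H'"
      using \<open>H' \<in> collapses H\<close> by (auto simp: collapses_def)
    have "card (verts1 H') \<le> card (verts1 H)" "card (verts2 H') \<le> card (verts2 H)"
      "card (edges H') \<le> card (edges H)"
      using fin by (simp_all add: card_image_le flip: fg)
    then show ?thesis
      by (intro image_eqI[where x = "(card (edges H'), card (verts1 H'), card (verts2 H'))"])
        (auto simp: collapse_weight_def)
  qed
  then have "collapse_weight \<beta> \<alpha> H ` collapses H \<subseteq> ?w ` ?I"
    by blast
  then show ?thesis
    by (rule finite_subset) simp
qed


section \<open>Projective planes\<close>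

text \<open>\<open>F\<^sup>3\<close> as a vector space over the field \<open>F\<close>, and its subspaces of dimension \<open>d\<close>.\<close>

definition space3 :: "'a ring \<Rightarrow> ('a, nat \<Rightarrow> 'a) module" where
  "space3 F = ring.func_space F {..<3}"

definition subspaces3 :: "'a ring \<Rightarrow> nat \<Rightarrow> (nat \<Rightarrow> 'a) set set" where
  "subspaces3 F d = {W. VectorSpace.subspace F W (space3 F) \<and>
     vectorspace.dim F (space3 F\<lparr>carrier := W\<rparr>) = d}"

definition incidence_graph :: "'a ring \<Rightarrow> ((nat \<Rightarrow> 'a) set, (nat \<Rightarrow> 'a) set) bigraph" where
  "incidence_graph F = Bigraph (subspaces3 F 1) (subspaces3 F 2)
     {(p, l). p \<in> subspaces3 F 1 \<and> l \<in> subspaces3 F 2 \<and> p \<subseteq> l}"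

end

theory Submission
  imports Defs "HOL-Real_Asymp.Real_Asymp"
begin

text \<open>Let \<open>m\<close> be the maximum of \<open>2|V(H')| - |E(H')|\<close> over the collapses \<open>H'\<close> of \<open>H\<close>. The limit
  statement says that the number of homomorphisms from \<open>H\<close> to \<open>G\<^sub>q\<close> is \<open>q\<^sup>m\<close> up to a constant
  factor. Only the following is used about \<open>G\<^sub>q\<close>: a vertex can be added to a partial homomorphism in
  about \<open>q\<^sup>2\<close>, \<open>q\<close> or \<open>1\<close> ways if it has \<open>0\<close>, \<open>1\<close> or \<open>2\<close> neighbours with distinct images among the
  vertices placed before.

  Lower bound: if a subgraph \<open>S\<close> of \<open>H'\<close> has minimum degree at least \<open>3\<close>, then identifying all
  vertices of the smaller class of \<open>S\<close> increases \<open>2|V| - |E|\<close>. So an optimal collapse is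
  \<open>2\<close>-degenerate, and its homomorphisms can be built by adding vertices with at most two neighbours
  among their predecessors.

  Upper bound: every homomorphism is an injective homomorphism of a collapse, so it suffices to bound
  the number of injective homomorphisms by \<open>q\<^sup>m\<close>. By induction one removes vertices of degree at
  most \<open>2\<close> and splits at cut vertices; in order to split, the image of a root \<open>x\<close> is kept fixed. In a
  \<open>2\<close>-connected graph of minimum degree at least \<open>3\<close> take an \<open>st\<close>-numbering: every vertex other than
  \<open>s\<close> and \<open>t\<close> has neighbours on both sides. One places the vertices either in this order or in the
  reversed one, and on average over the two orders a vertex loses at least \<open>3/2\<close> degrees of freedom.
  So the better of the two orders gives at most as many maps as the collapse of the smaller vertex
  class to a single vertex.\<close>

section \<open>Homomorphisms into incidence planes\<close>

text \<open>Points and lines live in one set \<open>W\<close>, told apart by \<open>c\<close>, and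
  the axioms are symmetric in the two colours, so one argument serves both classes. The factors 2
  absorb the exact values q^2 + q + 1 and q + 1; constant factors disappear after taking
  logarithms.\<close>

locale incidence_plane =
  fixes W :: "'w set" and c :: "'w \<Rightarrow> bool" and I :: "'w \<Rightarrow> 'w \<Rightarrow> bool" and q :: nat
  assumes finite_W: "finite W" and q_ge_2: "2 \<le> q"
    and I_sym: "I a b \<Longrightarrow> I b a" and I_W: "I a b \<Longrightarrow> a \<in> W" and I_col: "I a b \<Longrightarrow> c a \<noteq> c b"
    and class_le: "card {w \<in> W. c w = k} \<le> 2 * q ^ 2"
    and class_ge: "q ^ 2 \<le> card {w \<in> W. c w = k}"
    and deg_le: "w \<in> W \<Longrightarrow> card {u. I w u} \<le> 2 * q"
    and deg_ge: "w \<in> W \<Longrightarrow> q \<le> card {u. I w u}"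
    and common_unique: "\<lbrakk>a \<noteq> b; I a u; I b u; I a v; I b v\<rbrakk> \<Longrightarrow> u = v"
    and common_exists: "\<lbrakk>a \<in> W; b \<in> W; c a = c b\<rbrakk> \<Longrightarrow> \<exists>u. I a u \<and> I b u"
begin

lemma q_pos: "0 < q"
  using q_ge_2 by simp

lemma finite_I: "finite {u. I w u}"
  by (rule finite_subset[OF _ finite_W]) (use I_sym I_W in blast)

end

definition nbr :: "('v \<times> 'v) set \<Rightarrow> 'v set \<Rightarrow> 'v \<Rightarrow> 'v set" where
  "nbr E U v = {u \<in> U. (u, v) \<in> E \<or> (v, u) \<in> E}"

definition colour_maps :: "('v \<times> 'v) set \<Rightarrow> ('v \<Rightarrow> bool) \<Rightarrow> 'v set \<Rightarrow> 'w set \<Rightarrow> ('w \<Rightarrow> bool) \<Rightarrow> ('w \<Rightarrow> 'w \<Rightarrow> bool)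
    \<Rightarrow> ('v \<Rightarrow> 'w) set" where
  "colour_maps E s U W c I = {\<phi> \<in> U \<rightarrow>\<^sub>E W. (\<forall>v \<in> U. c (\<phi> v) = s v) \<and>
     (\<forall>u \<in> U. \<forall>v \<in> U. (u, v) \<in> E \<longrightarrow> I (\<phi> u) (\<phi> v))}"

definition rooted_maps :: "('v \<times> 'v) set \<Rightarrow> ('v \<Rightarrow> bool) \<Rightarrow> 'v set \<Rightarrow> 'v \<Rightarrow> 'w set \<Rightarrow> ('w \<Rightarrow> bool) \<Rightarrow> ('w \<Rightarrow> 'w \<Rightarrow> bool)
    \<Rightarrow> 'w \<Rightarrow> ('v \<Rightarrow> 'w) set" where
  "rooted_maps E s U x W c I p = {\<phi> \<in> colour_maps E s U W c I. inj_on \<phi> U \<and> \<phi> x = p}"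

lemma finite_colour_maps: "finite U \<Longrightarrow> finite W \<Longrightarrow> finite (colour_maps E s U W c I)"
  unfolding colour_maps_def by (rule finite_subset[of _ "U \<rightarrow>\<^sub>E W"]) (auto intro: finite_PiE)

lemma finite_rooted_maps: "finite U \<Longrightarrow> finite W \<Longrightarrow> finite (rooted_maps E s U x W c I p)"
  unfolding rooted_maps_def by (auto intro: finite_subset[OF _ finite_colour_maps])

lemma maps_restrict: "\<phi> \<in> colour_maps E s U W c I \<Longrightarrow> T \<subseteq> U \<Longrightarrow> restrict \<phi> T \<in> colour_maps E s T W c I"
  unfolding colour_maps_def by (auto simp: PiE_iff subset_iff)

lemma rooted_restrict:
  "\<phi> \<in> rooted_maps E s U x W c I p \<Longrightarrow> T \<subseteq> U \<Longrightarrow> y \<in> T \<Longrightarrow> restrict \<phi> T \<in> rooted_maps E s T y W c I (\<phi> y)"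
  unfolding rooted_maps_def by (auto simp: maps_restrict inj_on_def subset_iff)

lemma rooted_root:
  "\<phi> \<in> rooted_maps E s U x W c I p \<Longrightarrow> \<phi> x = p"
  by (simp add: rooted_maps_def)

section \<open>Counting along fibres\<close>

text \<open>A fibre bound of the form \<open>K / M\<close> is cleared of its denominator so that all
  estimates stay in \<open>nat\<close>.\<close>

lemma card_le_weighted_fibres:
  fixes K M :: nat
  assumes "finite B" "f ` A \<subseteq> B" "\<And>b. b \<in> B \<Longrightarrow> card {a \<in> A. f a = b} * M \<le> K"
  shows "card A * M \<le> card B * K"
proof (cases "finite A")
  case True
  have "card A = (\<Sum>b\<in>B. card {a \<in> A. f a = b})"
    using sum.group[OF True assms(1,2), of "\<lambda>_. 1 :: nat"] by simp
  then have "card A * M = (\<Sum>b\<in>B. card {a \<in> A. f a = b} * M)"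
    by (simp add: sum_distrib_right)
  also have "\<dots> \<le> card B * K"
    using sum_bounded_above[of B "\<lambda>b. card {a \<in> A. f a = b} * M" K] assms(3) by simp
  finally show ?thesis .
qed simp

lemma card_ge_weighted_fibres:
  fixes K M :: nat
  assumes "finite A" "finite B" "f ` A \<subseteq> B" "\<And>b. b \<in> B \<Longrightarrow> K \<le> card {a \<in> A. f a = b} * M"
  shows "card B * K \<le> card A * M"
proof -
  have "card A = (\<Sum>b\<in>B. card {a \<in> A. f a = b})"
    using sum.group[OF assms(1,2,3), of "\<lambda>_. 1 :: nat"] by simp
  then have "card A * M = (\<Sum>b\<in>B. card {a \<in> A. f a = b} * M)"
    by (simp add: sum_distrib_right)
  then show ?thesis
    using sum_bounded_below[of B K "\<lambda>b. card {a \<in> A. f a = b} * M"] assms(4) by simp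
qed

section \<open>Extending rooted maps vertex by vertex\<close>

locale coloured_graph =
  fixes E :: "('v \<times> 'v) set" and s :: "'v \<Rightarrow> bool"
  assumes edge_col: "(u, v) \<in> E \<Longrightarrow> s u \<and> \<not> s v"
begin

lemma nbr_col: "u \<in> nbr E U v \<Longrightarrow> s u \<noteq> s v"
  using edge_col by (auto simp: nbr_def)

lemma maps_nbr:
  assumes "incidence_plane W c I q" "\<phi> \<in> colour_maps E s U W c I" "v \<in> U" "u \<in> nbr E U v"
  shows "I (\<phi> u) (\<phi> v)"
  using assms incidence_plane.I_sym[OF assms(1)] by (auto simp: colour_maps_def nbr_def)

text \<open>An extension is determined by the image of \<open>y\<close>. Without neighbours in
  \<open>U\<close> this image ranges over a colour class, with one neighbour over the neighbours of
  a single vertex. With at least two neighbours it is a common neighbour of two vertices that are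
  distinct by injectivity, so at most one choice is left.\<close>

lemma rooted_extend:
  assumes "incidence_plane W c I q" "finite U" "y \<notin> U" "x \<in> U"
  shows "card (rooted_maps E s (insert y U) x W c I p) * q ^ min 2 (card (nbr E U y))
       \<le> 2 * q\<^sup>2 * card (rooted_maps E s U x W c I p)"
proof -
  interpret incidence_plane W c I q by fact
  let ?A = "rooted_maps E s (insert y U) x W c I p" and ?B = "rooted_maps E s U x W c I p"
  let ?N = "nbr E U y"
  let ?f = "\<lambda>\<phi>. restrict \<phi> U"
  define K where "K = (if card ?N = 0 then 2 * q\<^sup>2 else if card ?N = 1 then 2 * q else 1)"
  have finN: "finite ?N"
    using assms(2) by (simp add: nbr_def)
  have nb: "I (\<psi> u) (\<phi> y)" if "\<phi> \<in> ?A" "?f \<phi> = \<psi>" "u \<in> ?N" for \<phi> \<psi> u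
  proof -
    have "I (\<phi> u) (\<phi> y)"
      using that(1,3) by (intro maps_nbr[OF assms(1), of _ "insert y U"]) (auto simp: rooted_maps_def nbr_def)
    moreover have "\<psi> u = \<phi> u" using that by (auto simp: nbr_def)
    ultimately show ?thesis by simp
  qed
  have fib: "card {\<phi> \<in> ?A. ?f \<phi> = \<psi>} \<le> K" if \<psi>: "\<psi> \<in> ?B" for \<psi>
  proof -
    let ?F = "{\<phi> \<in> ?A. ?f \<phi> = \<psi>}"
    have inj: "inj_on (\<lambda>\<phi>. \<phi> y) ?F"
    proof (rule inj_onI)
      fix \<phi> \<phi>' assume a: "\<phi> \<in> ?F" "\<phi>' \<in> ?F" "\<phi> y = \<phi>' y"
      then have e: "\<phi> \<in> extensional (insert y U)" "\<phi>' \<in> extensional (insert y U)"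
        by (auto simp: rooted_maps_def colour_maps_def PiE_iff)
      have "\<phi> u = \<phi>' u" if "u \<in> U" for u
      proof -
        have "restrict \<phi> U u = restrict \<phi>' U u" using a(1,2) by simp
        then show ?thesis using that by simp
      qed
      then show "\<phi> = \<phi>'"
        using a(3) e by (intro extensionalityI[of _ "insert y U"]) auto
    qed
    have "(\<lambda>\<phi>. \<phi> y) ` ?F \<subseteq> {w \<in> W. c w = s y}"
      by (auto simp: rooted_maps_def colour_maps_def)
    then have K0: "card ?F \<le> 2 * q\<^sup>2"
      using card_inj_on_le[OF inj, of "{w \<in> W. c w = s y}"] class_le[of "s y"] finite_W by simp
    consider "card ?N = 0" | u where "?N = {u}" | u v where "u \<in> ?N" "v \<in> ?N" "u \<noteq> v"
    proof -
      show thesis if 1: "card ?N = 0 \<Longrightarrow> thesis" and 2: "\<And>u. ?N = {u} \<Longrightarrow> thesis"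
        and 3: "\<And>u v. \<lbrakk>u \<in> ?N; v \<in> ?N; u \<noteq> v\<rbrakk> \<Longrightarrow> thesis"
      proof (cases "?N = {}")
        case False
        then obtain u where u: "u \<in> ?N" by blast
        show thesis
        proof (cases "?N = {u}")
          case False
          then obtain v where "v \<in> ?N" "v \<noteq> u" using u by blast
          then show thesis using 3 u by blast
        qed (rule 2)
      qed (simp add: 1)
    qed
    then show ?thesis
    proof cases
      case 1 then show ?thesis using K0 by (simp add: K_def)
    next
      case 2
      have "u \<in> U" using 2 by (auto simp: nbr_def)
      then have psiW: "\<psi> u \<in> W" using \<psi> by (auto simp: rooted_maps_def colour_maps_def)
      have "(\<lambda>\<phi>. \<phi> y) ` ?F \<subseteq> {w. I (\<psi> u) w}"
        using nb[of _ \<psi> u] 2 by auto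
      then have "card ?F \<le> 2 * q"
        using card_inj_on_le[OF inj _ finite_I, of "\<psi> u"] by (intro order_trans[OF _ deg_le[OF psiW]])
      then show ?thesis using 2 by (simp add: K_def)
    next
      case 3
      have "\<psi> u \<noteq> \<psi> v"
        using \<psi> 3 by (auto simp: rooted_maps_def nbr_def inj_on_def)
      then have "\<phi> y = \<phi>' y" if "\<phi> \<in> ?F" "\<phi>' \<in> ?F" for \<phi> \<phi>'
        using that by (intro common_unique[OF \<open>\<psi> u \<noteq> \<psi> v\<close>] nb 3) auto
      then have "\<phi> = \<phi>'" if "\<phi> \<in> ?F" "\<phi>' \<in> ?F" for \<phi> \<phi>'
        using inj_onD[OF inj] that by blast
      then have "card ?F \<le> 1"
        by (cases "finite ?F") (auto simp: card_le_Suc0_iff_eq)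
      moreover have "K \<ge> 1" using q_ge_2 by (auto simp: K_def)
      ultimately show ?thesis by simp
    qed
  qed
  have "?f ` ?A \<subseteq> ?B"
  proof
    fix \<psi> assume "\<psi> \<in> ?f ` ?A"
    then obtain \<phi> where "\<phi> \<in> ?A" "\<psi> = ?f \<phi>" by blast
    then show "\<psi> \<in> ?B"
      using rooted_restrict[of \<phi> E s "insert y U" x W c I p U x] rooted_root[of \<phi>] assms(4) by auto
  qed
  then have "card ?A \<le> card ?B * K"
    using card_le_weighted_fibres[OF finite_rooted_maps[OF assms(2) finite_W],
      where f = ?f and A = ?A and M = 1 and K = K] fib by simp
  then have "card ?A * q ^ min 2 (card ?N) \<le> card ?B * K * q ^ min 2 (card ?N)"
    by simp
  also have "K * q ^ min 2 (card ?N) \<le> 2 * q\<^sup>2"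
  proof -
    consider "card ?N = 0" | "card ?N = 1" | "card ?N \<ge> 2" by linarith
    then show ?thesis by cases (auto simp: K_def power2_eq_square)
  qed
  then have "card ?B * K * q ^ min 2 (card ?N) \<le> 2 * q\<^sup>2 * card ?B"
    by (metis mult.assoc mult.commute mult_le_mono2)
  finally show ?thesis .
qed

text \<open>The vertices other than \<open>x\<close> are placed in order of increasing
  \<open>r\<close>, each by \<open>rooted_extend\<close>, and the factors 2 of the steps multiply to
  \<open>C\<close>. The root is present from the start, but it is counted as a predecessor of
  \<open>v\<close> only if \<open>r x < r v\<close>.\<close>

lemma rooted_rank_bound:
  fixes r :: "'v \<Rightarrow> real"
  assumes "finite U" "x \<in> U" 
  shows "\<exists>C. \<forall>(W :: 'w set) c I q p. incidence_plane W c I q \<longrightarrow>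
     card (rooted_maps E s U x W c I p) * q ^ (\<Sum>v\<in>U - {x}. min 2 (card {u \<in> nbr E U v. r u < r v}))
       \<le> C * q ^ (2 * card (U - {x}))"
  using assms
proof (induction "card U" arbitrary: U)
  case 0 then show ?case by auto
next
  case (Suc n)
  show ?case
  proof (cases "U = {x}")
    case True
    have "card (rooted_maps E s U x W c I p) \<le> 1" if "incidence_plane W c I q"
      for W :: "'w set" and c I q p
    proof -
      have "\<phi> = \<phi>'" if "\<phi> \<in> rooted_maps E s U x W c I p" "\<phi>' \<in> rooted_maps E s U x W c I p" for \<phi> \<phi>'
        using that True by (auto simp: rooted_maps_def colour_maps_def PiE_iff intro!: extensionalityI[of _ "{x}"])
      then show ?thesis
        by (cases "finite (rooted_maps E s U x W c I p)") (auto simp: card_le_Suc0_iff_eq)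
    qed
    then show ?thesis using True by (intro exI[of _ 1]) auto
  next
    case False
    have ne: "finite (U - {x})" "U - {x} \<noteq> {}" using Suc.prems False by auto
    then have "Max (r ` (U - {x})) \<in> r ` (U - {x})" by (intro Max_in) auto
    then obtain y where y: "y \<in> U - {x}" "r y = Max (r ` (U - {x}))" by (metis imageE)
    then have y: "y \<in> U - {x}" "\<And>v. v \<in> U - {x} \<Longrightarrow> r v \<le> r y"
      using ne by auto
    define U' where "U' = U - {y}"
    have U: "U = insert y U'" "y \<notin> U'" "finite U'" "x \<in> U'" "y \<noteq> x"
      using Suc.prems y by (auto simp: U'_def)
    let ?g = "\<lambda>U v. min 2 (card {u \<in> nbr E U v. r u < r v})"
    obtain C where C: "\<And>(W :: 'w set) c I q p. incidence_plane W c I q \<Longrightarrow>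
       card (rooted_maps E s U' x W c I p) * q ^ (\<Sum>v\<in>U' - {x}. ?g U' v) \<le> C * q ^ (2 * card (U' - {x}))"
    proof -
      have "n = card U'" using Suc.hyps(2) U by simp
      from Suc.hyps(1)[OF this U(3,4)] show thesis using that by blast
    qed
    \<comment> \<open>\<open>y\<close> has maximal rank among the vertices other than
      \<open>x\<close>, so it is a lower neighbour of none of them and removing it leaves their
      summands unchanged.\<close>
    have g: "?g U v = ?g U' v" if "v \<in> U' - {x}" for v
    proof -
      have "{u \<in> nbr E U v. r u < r v} = {u \<in> nbr E U' v. r u < r v}"
        using y(2)[of v] that U by (auto simp: nbr_def)
      then show ?thesis by simp
    qed
    have gy: "?g U y \<le> min 2 (card (nbr E U' y))"
    proof -
      have "{u \<in> nbr E U y. r u < r y} \<subseteq> nbr E U' y" using U by (auto simp: nbr_def)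
      then show ?thesis using U(3) card_mono[of "nbr E U' y"]
        by (fastforce simp: nbr_def intro!: min.mono)
    qed
    have Ux: "U - {x} = insert y (U' - {x})" using U by auto
    have S: "(\<Sum>v\<in>U - {x}. ?g U v) = ?g U y + (\<Sum>v\<in>U' - {x}. ?g U' v)"
    proof -
      have "(\<Sum>v\<in>U' - {x}. ?g U v) = (\<Sum>v\<in>U' - {x}. ?g U' v)"
        by (rule sum.cong) (simp_all only: g)
      then show ?thesis
        unfolding Ux using U(2,3) by (subst sum.insert) simp_all
    qed
    have cd: "card (U - {x}) = Suc (card (U' - {x}))" unfolding Ux using U by simp
    have "card (rooted_maps E s U x W c I p) * q ^ (\<Sum>v\<in>U - {x}. ?g U v)
           \<le> (2 * C) * q ^ (2 * card (U - {x}))" if P: "incidence_plane W c I q" for W :: "'w set" and c I q p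
    proof -
      interpret incidence_plane W c I q by fact
      have "q ^ ?g U y \<le> q ^ min 2 (card (nbr E U' y))"
        using gy q_pos by (intro power_increasing) auto
      then have "card (rooted_maps E s U x W c I p) * q ^ ?g U y
         \<le> card (rooted_maps E s U x W c I p) * q ^ min 2 (card (nbr E U' y))"
        by (rule mult_le_mono2)
      also have "\<dots> \<le> 2 * q\<^sup>2 * card (rooted_maps E s U' x W c I p)"
        using rooted_extend[OF P U(3,2,4), of p] unfolding U(1)[symmetric] .
      finally have "card (rooted_maps E s U x W c I p) * q ^ ?g U y * q ^ (\<Sum>v\<in>U' - {x}. ?g U' v)
         \<le> 2 * q\<^sup>2 * card (rooted_maps E s U' x W c I p) * q ^ (\<Sum>v\<in>U' - {x}. ?g U' v)"
        by (rule mult_le_mono1)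
      also have "\<dots> = 2 * q\<^sup>2 * (card (rooted_maps E s U' x W c I p) * q ^ (\<Sum>v\<in>U' - {x}. ?g U' v))"
        by (rule mult.assoc)
      also have "\<dots> \<le> 2 * q\<^sup>2 * (C * q ^ (2 * card (U' - {x})))"
        by (rule mult_le_mono2[OF C[OF P]])
      also have "card (rooted_maps E s U x W c I p) * q ^ ?g U y * q ^ (\<Sum>v\<in>U' - {x}. ?g U' v)
         = card (rooted_maps E s U x W c I p) * q ^ (\<Sum>v\<in>U - {x}. ?g U v)"
        unfolding S power_add by (rule mult.assoc)
      finally show ?thesis unfolding cd by (simp only: mult_Suc_right power_add mult.assoc mult.left_commute)
    qed
    then show ?thesis by blast
  qed
qed

subsection \<open>Numberings and cut vertices\<close>

definition linked :: "'v set \<Rightarrow> 'v \<Rightarrow> 'v \<Rightarrow> bool" where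
  "linked X u v \<longleftrightarrow> (u, v) \<in> {(a, b). b \<in> X \<and> b \<in> nbr E X a}\<^sup>*"

text \<open>A walk becomes a simple path: when the next vertex already lies on the path, the path is
  cut off there. The form \<open>ps @ [w]\<close> keeps the end point visible.\<close>

lemma linked_path:
  assumes "linked X u w" "u \<in> X"
  shows "\<exists>ps. distinct (ps @ [w]) \<and> hd (ps @ [w]) = u \<and> set (ps @ [w]) \<subseteq> X \<and>
     successively (\<lambda>a b. b \<in> nbr E X a) (ps @ [w])"
  using assms(1) unfolding linked_def
proof (induction rule: rtrancl_induct)
  case base
  show ?case using assms(2) by (intro exI[of _ "[]"]) auto
next
  case (step y z)
  then obtain ps where ps: "distinct (ps @ [y])" "hd (ps @ [y]) = u" "set (ps @ [y]) \<subseteq> X"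
     "successively (\<lambda>a b. b \<in> nbr E X a) (ps @ [y])" by blast
  show ?case
  proof (cases "z \<in> set (ps @ [y])")
    case True
    then obtain as bs where ab: "ps @ [y] = as @ z # bs" by (meson split_list)
    then have "ps @ [y] = (as @ [z]) @ bs" by simp
    with ps show ?thesis
      by (intro exI[of _ as]) (simp add: successively_append_iff hd_append split: if_splits)
  next
    case False
    with ps step.hyps(2) show ?thesis
      by (intro exI[of _ "ps @ [y]"]) (auto simp: successively_append_iff hd_append)
  qed
qed

text \<open>An \<open>st\<close>-numbering of the subgraph induced on \<open>X\<close>.\<close>

definition st_rank :: "'v set \<Rightarrow> 'v \<Rightarrow> 'v \<Rightarrow> ('v \<Rightarrow> real) \<Rightarrow> bool" where
  "st_rank X x t r \<longleftrightarrow> x \<in> X \<and> t \<in> X \<and> inj_on r X \<and>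
     (\<forall>v \<in> X - {x}. r x < r v) \<and> (\<forall>v \<in> X - {t}. r v < r t) \<and>
     (\<forall>v \<in> X - {x, t}. (\<exists>u \<in> nbr E X v. r u < r v) \<and> (\<exists>u \<in> nbr E X v. r v < r u))"

text \<open>The inner vertices \<open>ps\<close> of an ear from \<open>a\<close> to \<open>b\<close>
  receive increasing values strictly between \<open>r a\<close> and the next larger value of
  \<open>r\<close> on \<open>X\<close>. Each then has its predecessor on the ear below and its
  successor above it, while the order of the old vertices does not change. Real ranks always leave
  room for this.\<close>

lemma st_rank_ear:
  assumes st: "st_rank X x t r" and fin: "finite X"
    and ab: "a \<in> X" "b \<in> X" "r a < r b"
    and ps: "ps \<noteq> []" "distinct ps" "set ps \<inter> X = {}"
    and suc: "successively (\<lambda>a b. b \<in> nbr E UNIV a) (a # ps @ [b])"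
  shows "\<exists>r'. st_rank (X \<union> set ps) x t r'"
proof -
  \<comment> \<open>The gap between \<open>r a\<close> and the next larger rank; \<open>b\<close>
    witnesses that a larger rank exists.\<close>
  define D where "D = Min ((\<lambda>v. r v - r a) ` {v \<in> X. r a < r v})"
  have D: "0 < D" "\<And>v. v \<in> X \<Longrightarrow> r a < r v \<Longrightarrow> r a + D \<le> r v"
  proof -
    have f: "finite ((\<lambda>v. r v - r a) ` {v \<in> X. r a < r v})" "(\<lambda>v. r v - r a) ` {v \<in> X. r a < r v} \<noteq> {}"
      using fin ab by auto
    then show "0 < D" unfolding D_def by (subst Min_gr_iff) auto
    show "r a + D \<le> r v" if "v \<in> X" "r a < r v" for v
      using Min_le[OF f(1), of "r v - r a"] that unfolding D_def by auto
  qed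
  define k where "k = length ps"
  \<comment> \<open>The \<open>k\<close> inner vertices divide the gap into \<open>k + 1\<close>
    equal steps, so even the last one stays below \<open>r a + D\<close>.\<close>
  define e where "e = D / real (k + 1)"
  have e: "0 < e" "e * real (k + 1) = D"
    using D(1) by (auto simp: e_def field_simps)
  define ix where "ix p = (THE i. i < k \<and> ps ! i = p)" for p
  have ix: "ix (ps ! i) = i" if "i < k" for i
    unfolding ix_def using that ps(2) by (auto simp: k_def nth_eq_iff_index_eq)
  define r' where "r' v = (if v \<in> X then r v else r a + e * real (ix v + 1))" for v
  have r'X: "r' v = r v" if "v \<in> X" for v using that by (simp add: r'_def)
  have psX: "ps ! i \<notin> X" if "i < k" for i using that ps(3) nth_mem[of i ps] by (auto simp: k_def simp del: nth_mem)
  have r'p: "r' (ps ! i) = r a + e * real (i + 1)" if "i < k" for i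
    using that psX by (simp add: r'_def ix)
  have lo: "r a < r' (ps ! i)" if "i < k" for i
    using e(1) by (simp add: r'p[OF that])
  have hi: "r' (ps ! i) < r a + D" if "i < k" for i
    unfolding r'p[OF that] e(2)[symmetric] using e(1) that by simp
  have setps: "v \<in> set ps \<longleftrightarrow> (\<exists>i<k. v = ps ! i)" for v
    by (auto simp: k_def in_set_conv_nth)
  let ?Y = "X \<union> set ps"
  have k0: "0 < k" using ps(1) by (simp add: k_def)
  have nth: "(a # ps @ [b]) ! Suc i = (if i < k then ps ! i else b)" if "i \<le> k" for i
    using that by (auto simp: k_def nth_append)
  have adj: "(a # ps @ [b]) ! Suc i \<in> nbr E UNIV ((a # ps @ [b]) ! i)" if "i \<le> k" for i
    using suc that by (auto simp: successively_conv_nth k_def)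
  have below: "\<exists>u \<in> nbr E ?Y (ps ! i). r' u < r' (ps ! i)" if i: "i < k" for i
  proof (cases i)
    case 0
    have "ps ! 0 \<in> nbr E UNIV a" using adj[of 0] nth[of 0] k0 by simp
    then have "a \<in> nbr E ?Y (ps ! i)" using 0 ab by (auto simp: nbr_def)
    moreover have "r' a < r' (ps ! i)" using lo[OF i] ab r'X by simp
    ultimately show ?thesis by blast
  next
    case (Suc j)
    have "ps ! i \<in> nbr E UNIV (ps ! j)" using adj[of i] nth[of i] nth[of j] i Suc by simp
    then have "ps ! j \<in> nbr E ?Y (ps ! i)" using Suc i by (auto simp: nbr_def k_def)
    moreover have "r' (ps ! j) < r' (ps ! i)" using i Suc e(1) by (simp add: r'p)
    ultimately show ?thesis by blast
  qed
  have above: "\<exists>u \<in> nbr E ?Y (ps ! i). r' (ps ! i) < r' u" if i: "i < k" for i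
  proof (cases "Suc i < k")
    case False
    then have "b \<in> nbr E UNIV (ps ! i)" using adj[of "Suc i"] nth[of i] nth[of "Suc i"] i by simp
    then have "b \<in> nbr E ?Y (ps ! i)" using ab by (auto simp: nbr_def)
    moreover have "r' (ps ! i) < r' b" using hi[OF i] D(2)[of b] ab r'X by simp
    ultimately show ?thesis by blast
  next
    case True
    have "ps ! Suc i \<in> nbr E UNIV (ps ! i)" using adj[of "Suc i"] nth[of "Suc i"] nth[of i] i True by simp
    then have "ps ! Suc i \<in> nbr E ?Y (ps ! i)" using True by (auto simp: nbr_def k_def)
    moreover have "r' (ps ! i) < r' (ps ! Suc i)" using i True e(1) by (simp add: r'p)
    ultimately show ?thesis by blast
  qed
  have xa: "r x \<le> r a" and bt: "r b \<le> r t"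
    using st ab unfolding st_rank_def by (metis DiffI less_imp_le order_refl singletonD)+
  have sep: "r' (ps ! i) \<noteq> r v" if "i < k" "v \<in> X" for i v
    using lo[OF that(1)] hi[OF that(1)] D(2)[OF that(2)] by (cases "r a < r v") auto
  have "inj_on r' ?Y"
  proof (rule inj_onI)
    fix u v assume uv: "u \<in> ?Y" "v \<in> ?Y" "r' u = r' v"
    have injr: "inj_on r X" using st by (simp add: st_rank_def)
    consider "u \<in> X" "v \<in> X" | i where "i < k" "u = ps ! i" "v \<in> X" | i where "i < k" "v = ps ! i" "u \<in> X"
      | i j where "i < k" "u = ps ! i" "j < k" "v = ps ! j"
      using uv setps by blast
    then show "u = v"
    proof cases
      case 1 then show ?thesis using injr uv r'X by (auto dest: inj_onD)
    next
      case 2 then show ?thesis using sep uv r'X by metis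
    next
      case 3 then show ?thesis using sep uv r'X by metis
    next
      case 4 then show ?thesis using uv e(1) by (simp add: r'p)
    qed
  qed
  moreover have "\<forall>v \<in> ?Y - {x}. r' x < r' v"
    using st xa lo by (force simp: st_rank_def r'X setps)
  moreover have "\<forall>v \<in> ?Y - {t}. r' v < r' t"
  proof
    fix v assume v: "v \<in> ?Y - {t}"
    have "r' (ps ! i) < r t" if "i < k" for i
      using hi[OF that] D(2)[of b] ab bt by simp
    then show "r' v < r' t" using st v by (force simp: st_rank_def r'X setps)
  qed
  moreover have "(\<exists>u \<in> nbr E ?Y v. r' u < r' v) \<and> (\<exists>u \<in> nbr E ?Y v. r' v < r' u)"
    if v: "v \<in> ?Y - {x, t}" for v
  proof (cases "v \<in> X")
    case True
    then obtain u w where "u \<in> nbr E X v" "r u < r v" "w \<in> nbr E X v" "r v < r w"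
      using st v unfolding st_rank_def by blast
    then have "u \<in> nbr E ?Y v" "r' u < r' v" "w \<in> nbr E ?Y v" "r' v < r' w"
      using True by (auto simp: nbr_def r'X)
    then show ?thesis by blast
  next
    case False
    then obtain i where "i < k" "v = ps ! i" using v setps by blast
    then show ?thesis using above[of i] below[of i] by simp
  qed
  ultimately have "st_rank ?Y x t r'"
    using st unfolding st_rank_def by simp
  then show ?thesis by blast
qed

text \<open>Take a largest vertex set \<open>X\<close> with an st-numbering. If a vertex is left
  over, its component \<open>K\<close> outside \<open>X\<close> is attached to at most one vertex of
  \<open>X\<close>: two attachment vertices could be joined by a path through \<open>K\<close>, an
  ear that would enlarge \<open>X\<close>.\<close>

lemma st_rank_or_cut:
  assumes fin: "finite U" and x: "x \<in> U" "t \<in> U" "x \<noteq> t"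
  shows "(\<exists>r. st_rank U x t r) \<or>
    (\<exists>K z. K \<noteq> {} \<and> K \<subseteq> U \<and> x \<notin> K \<and> t \<notin> K \<and> z \<in> U - K \<and> (\<forall>v \<in> K. nbr E U v \<subseteq> insert z K))"
proof -
  let ?P = "\<lambda>X. X \<subseteq> U \<and> (\<exists>r. st_rank X x t r)"
  \<comment> \<open>The condition on neighbours concerns only vertices other than \<open>x\<close>
    and \<open>t\<close>, so the numbering of the pair is valid whether or not the two are
    adjacent.\<close>
  have "st_rank {x, t} x t (\<lambda>v. if v = x then 0 else 1)"
    using x by (auto simp: st_rank_def inj_on_def)
  then have "?P {x, t}" using x by blast
  moreover have "\<forall>X. ?P X \<longrightarrow> card X < Suc (card U)"
    using fin by (auto simp: less_Suc_eq_le intro: card_mono)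
  ultimately have "\<exists>X. ?P X \<and> (\<forall>Y. ?P Y \<longrightarrow> card Y \<le> card X)"
    by (rule ex_has_greatest_nat[of ?P "{x, t}" card "Suc (card U)"])
  then obtain X where "?P X \<and> (\<forall>Y. ?P Y \<longrightarrow> card Y \<le> card X)" ..
  then have X: "?P X" and X_max: "\<And>Y. ?P Y \<Longrightarrow> card Y \<le> card X"
    by simp_all
  obtain r where r: "st_rank X x t r" using X(1) by blast
  have finX: "finite X" using X(1) fin finite_subset by blast
  have xtX: "x \<in> X" "t \<in> X" using r by (auto simp: st_rank_def)
  show ?thesis
  proof (cases "X = U")
    case True then show ?thesis using r by blast
  next
    case False
    then obtain u where u: "u \<in> U" "u \<notin> X" using X(1) by blast
    define K where "K = {w. linked (U - X) u w}"
    have uK: "u \<in> K" by (simp add: K_def linked_def)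
    have KU: "K \<subseteq> U - X"
    proof
      fix w assume "w \<in> K"
      then have "(u, w) \<in> {(a, b). b \<in> U - X \<and> b \<in> nbr E (U - X) a}\<^sup>*" by (simp add: K_def linked_def)
      then show "w \<in> U - X" by (cases rule: rtranclE) (use u in auto)
    qed
    have Kcl: "w \<in> K" if "v \<in> K" "w \<in> U - X" "w \<in> nbr E U v" for v w
    proof -
      have "w \<in> nbr E (U - X) v" using that by (auto simp: nbr_def)
      then show ?thesis using that unfolding K_def linked_def
        by (auto intro: rtrancl.rtrancl_into_rtrancl)
    qed
    \<comment> \<open>Two attachment vertices with different ranks are excluded; since
      \<open>r\<close> is injective on \<open>X\<close>, this excludes any two distinct ones. The
      end points \<open>v\<close> and \<open>w\<close> of the ear inside \<open>K\<close> may
      coincide.\<close>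
    have "\<not> (a \<in> X \<and> b \<in> X \<and> r a < r b \<and> v \<in> K \<and> w \<in> K \<and> a \<in> nbr E U v \<and> b \<in> nbr E U w)" for a b v w
    proof
      assume h: "a \<in> X \<and> b \<in> X \<and> r a < r b \<and> v \<in> K \<and> w \<in> K \<and> a \<in> nbr E U v \<and> b \<in> nbr E U w"
      let ?R = "{(a, b). b \<in> U - X \<and> b \<in> nbr E (U - X) a}"
      have "(u, v) \<in> ?R\<^sup>*" "(u, w) \<in> ?R\<^sup>*" using h by (auto simp: K_def linked_def)
      moreover have "(v, u) \<in> ?R\<^sup>*"
        using \<open>(u, v) \<in> ?R\<^sup>*\<close>
      proof (induction rule: rtrancl_induct)
        case (step y z)
        have "y \<in> U - X" using step(1) by (cases rule: rtranclE) (use u in auto)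
        then have "(z, y) \<in> ?R" using step(2) by (auto simp: nbr_def)
        then show ?case using step(3) by (rule converse_rtrancl_into_rtrancl)
      qed simp
      ultimately have "linked (U - X) v w" unfolding linked_def by (meson rtrancl_trans)
      moreover have "v \<in> U - X" using h KU by blast
      ultimately obtain qs where qs: "distinct (qs @ [w])" "hd (qs @ [w]) = v" "set (qs @ [w]) \<subseteq> U - X"
        "successively (\<lambda>a b. b \<in> nbr E (U - X) a) (qs @ [w])"
        using linked_path by blast
      define ps where "ps = qs @ [w]"
      have ps: "ps \<noteq> []" "distinct ps" "set ps \<inter> X = {}" "set ps \<subseteq> U" "hd ps = v" "last ps = w"
        using qs by (auto simp: ps_def)
      have "successively (\<lambda>a b. b \<in> nbr E UNIV a) ps"
        using qs(4) unfolding ps_def by (rule successively_mono) (auto simp: nbr_def)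
      moreover have "v \<in> nbr E UNIV a" "b \<in> nbr E UNIV w" using h by (auto simp: nbr_def)
      ultimately have "successively (\<lambda>a b. b \<in> nbr E UNIV a) (a # ps @ [b])"
        using ps by (auto simp: successively_append_iff successively_Cons)
      then obtain r' where "st_rank (X \<union> set ps) x t r'"
        using st_rank_ear[OF r finX _ _ _ ps(1-3), of a b] h by blast
      then have "card (X \<union> set ps) \<le> card X" using X(1) ps(4) by (intro X_max) blast
      moreover have "card (X \<union> set ps) = card X + card (set ps)"
        using finX ps(3) by (intro card_Un_disjoint) auto
      ultimately show False using ps(1) by simp
    qed
    then have uniq: "a = b" if "a \<in> X" "b \<in> X" "v \<in> K" "w \<in> K" "a \<in> nbr E U v" "b \<in> nbr E U w" for a b v w
      using r that inj_onD[of r X a b] unfolding st_rank_def by (metis linorder_neqE_linordered_idom)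
    \<comment> \<open>The attachment vertices of \<open>K\<close>. If there are none,
      \<open>K\<close> is cut off completely and any vertex of \<open>X\<close> can serve as
      \<open>z\<close>.\<close>
    define N where "N = {a \<in> X. \<exists>v \<in> K. a \<in> nbr E U v}"
    obtain z where z: "z \<in> X" "N \<subseteq> {z}"
      using uniq xtX(1) unfolding N_def by (cases "N = {}") (use N_def in blast)+
    have "nbr E U v \<subseteq> insert z K" if "v \<in> K" for v
    proof
      fix w assume w: "w \<in> nbr E U v"
      then have "w \<in> U" by (simp add: nbr_def)
      then show "w \<in> insert z K" using w that Kcl z(2) by (cases "w \<in> X") (auto simp: N_def)
    qed
    moreover have "z \<in> U - K" using z KU X(1) by blast
    ultimately show ?thesis using uK KU xtX by blast
  qed
qed

subsection \<open>Upper bound\<close>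

text \<open>The \<open>+ 2\<close> in the exponent accounts for the two degrees of freedom of the root.\<close>

definition rooted_bound :: "'w itself \<Rightarrow> 'v set \<Rightarrow> 'v \<Rightarrow> bool" where
  "rooted_bound _ U x \<longleftrightarrow> (\<exists>\<pi> C. \<pi> ` U \<subseteq> U \<and> \<pi> x = x \<and> (\<forall>v \<in> U. s (\<pi> v) = s v) \<and>
     (\<forall>(W :: 'w set) c I q p. incidence_plane W c I q \<longrightarrow>
        card (rooted_maps E s U x W c I p) * q ^ (card (map_prod \<pi> \<pi> ` (E \<inter> U \<times> U)) + 2)
          \<le> C * q ^ (2 * card (\<pi> ` U))))"

lemma edges_insert:
  assumes "y \<notin> U"
  shows "E \<inter> insert y U \<times> insert y U = E \<inter> U \<times> U \<union> (\<lambda>u. if s y then (y, u) else (u, y)) ` nbr E U y"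
proof -
  have "(y, y) \<notin> E" using edge_col by blast
  moreover have "s y" if "(y, u) \<in> E" for u using edge_col that by blast
  moreover have "\<not> s y" if "(u, y) \<in> E" for u using edge_col that by blast
  ultimately show ?thesis by (auto simp: nbr_def image_iff split: if_splits)
qed

lemma rooted_bound_singleton: "rooted_bound TYPE('w) {x} x"
proof -
  have "\<exists>C. \<forall>(W :: 'w set) c I q p. incidence_plane W c I q \<longrightarrow>
      card (rooted_maps E s {x} x W c I p) * q ^ (\<Sum>v\<in>{x} - {x}. min 2 (card {u \<in> nbr E {x} v. (0::real) < 0}))
        \<le> C * q ^ (2 * card ({x} - {x}))"
    by (rule rooted_rank_bound) simp_all
  then have "\<exists>C. \<forall>(W :: 'w set) c I q p. incidence_plane W c I q \<longrightarrow>
      card (rooted_maps E s {x} x W c I p) \<le> C"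
    by simp
  then obtain C where C: "\<And>(W :: 'w set) c I q p. incidence_plane W c I q \<Longrightarrow>
      card (rooted_maps E s {x} x W c I p) \<le> C"
    by blast
  have E: "E \<inter> {x} \<times> {x} = {}" using edge_col by blast
  have "card (rooted_maps E s {x} x W c I p) * q ^ (card (map_prod id id ` (E \<inter> {x} \<times> {x})) + 2)
          \<le> C * q ^ (2 * card (id ` {x}))" if "incidence_plane W c I q" for W :: "'w set" and c I q p
    using C[OF that, of p] unfolding E by (simp add: power2_eq_square)
  then show ?thesis unfolding rooted_bound_def by (intro exI[of _ id] exI[of _ C]) simp
qed

text \<open>The collapse of \<open>U\<close> is extended by fixing \<open>y\<close>. With d
  neighbours this adds one vertex and at most d edges, which changes the bound by a factor of at
  least q^(2 - d), and by \<open>rooted_extend\<close> the number of maps grows by at most twice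
  that factor. Here d <= 2 is essential, as further neighbours do not reduce the number of maps any
  more.\<close>

lemma rooted_bound_insert:
  assumes "rooted_bound TYPE('w) U x" "finite U" "x \<in> U" "y \<notin> U" "card (nbr E U y) \<le> 2"
  shows "rooted_bound TYPE('w) (insert y U) x"
proof -
  obtain \<pi> C where \<pi>: "\<pi> ` U \<subseteq> U" "\<pi> x = x" "\<forall>v \<in> U. s (\<pi> v) = s v"
    and C: "\<And>(W :: 'w set) c I q p. incidence_plane W c I q \<Longrightarrow>
        card (rooted_maps E s U x W c I p) * q ^ (card (map_prod \<pi> \<pi> ` (E \<inter> U \<times> U)) + 2)
          \<le> C * q ^ (2 * card (\<pi> ` U))"
    using assms(1) unfolding rooted_bound_def by blast
  define \<rho> where "\<rho> = \<pi>(y := y)"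
  have \<rho>U: "\<rho> v = \<pi> v" if "v \<in> U" for v using that assms(4) by (auto simp: \<rho>_def)
  have im: "\<rho> ` insert y U = insert y (\<pi> ` U)" using assms(4) by (auto simp: \<rho>_def)
  have yn: "y \<notin> \<pi> ` U" using \<pi>(1) assms(4) by blast
  have ck: "card (\<rho> ` insert y U) = Suc (card (\<pi> ` U))"
    unfolding im using yn assms(2) by simp
  let ?d = "card (nbr E U y)" and ?e = "card (map_prod \<pi> \<pi> ` (E \<inter> U \<times> U))"
  let ?e' = "card (map_prod \<rho> \<rho> ` (E \<inter> insert y U \<times> insert y U))"
  let ?F = "(\<lambda>u. if s y then (y, u) else (u, y)) ` nbr E U y"
  have fin: "finite (nbr E U y)" using assms(2) by (simp add: nbr_def)
  have E\<rho>: "map_prod \<rho> \<rho> ` (E \<inter> U \<times> U) = map_prod \<pi> \<pi> ` (E \<inter> U \<times> U)"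
    by (intro image_cong) (auto simp: \<rho>U)
  have "?e' \<le> ?e + card (map_prod \<rho> \<rho> ` ?F)"
    unfolding edges_insert[OF assms(4)] image_Un E\<rho> by (rule card_Un_le)
  also have "card (map_prod \<rho> \<rho> ` ?F) \<le> ?d"
    using fin by (intro order_trans[OF card_image_le] card_image_le finite_imageI)
  finally have e': "?e' \<le> ?e + ?d" by simp
  have "card (rooted_maps E s (insert y U) x W c I p) * q ^ (?e' + 2) \<le> (2 * C) * q ^ (2 * card (\<rho> ` insert y U))"
    if P: "incidence_plane W c I q" for W :: "'w set" and c I q p
  proof -
    interpret incidence_plane W c I q by fact
    let ?A = "card (rooted_maps E s (insert y U) x W c I p)" and ?B = "card (rooted_maps E s U x W c I p)"
    have "?A * q ^ ?d \<le> 2 * q\<^sup>2 * ?B"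
      using rooted_extend[OF P assms(2,4,3), of p] assms(5) by (simp add: min.absorb2)
    have "?A * q ^ (?e' + 2) \<le> ?A * q ^ (?d + (?e + 2))"
      using e' q_pos by (intro mult_le_mono2 power_increasing) auto
    also have "\<dots> = (?A * q ^ ?d) * q ^ (?e + 2)" by (simp only: power_add mult.assoc)
    also have "\<dots> \<le> (2 * q\<^sup>2 * ?B) * q ^ (?e + 2)" by (rule mult_le_mono1) fact
    also have "\<dots> = 2 * q\<^sup>2 * (?B * q ^ (?e + 2))" by (rule mult.assoc)
    also have "\<dots> \<le> 2 * q\<^sup>2 * (C * q ^ (2 * card (\<pi> ` U)))" by (rule mult_le_mono2[OF C[OF P]])
    also have "\<dots> = (2 * C) * q ^ (2 * card (\<rho> ` insert y U))"
      unfolding ck by (simp only: mult_Suc_right power_add mult.assoc mult.left_commute)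
    finally show ?thesis .
  qed
  moreover have "\<rho> ` insert y U \<subseteq> insert y U" unfolding im using \<pi>(1) by blast
  moreover have "\<rho> x = x" using \<rho>U[OF assms(3)] \<pi>(2) by simp
  moreover have "\<forall>v \<in> insert y U. s (\<rho> v) = s v" using \<pi>(3) by (simp add: \<rho>_def)
  ultimately show ?thesis unfolding rooted_bound_def by blast
qed

text \<open>Once a map of \<open>U - K\<close> is fixed, the image of \<open>z\<close> is known, and
  the extensions over \<open>K\<close> are maps of \<open>insert z K\<close> rooted at
  \<open>z\<close>. So the two bounds multiply, and the two collapses are glued at the image of
  \<open>z\<close>.\<close>

lemma rooted_bound_cut:
  assumes A: "rooted_bound TYPE('w) (U - K) x" and B: "rooted_bound TYPE('w) (insert z K) z"
    and fin: "finite U" and K: "K \<subseteq> U" "x \<in> U" "x \<notin> K" "z \<in> U - K"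
    and cut: "\<And>v. v \<in> K \<Longrightarrow> nbr E U v \<subseteq> insert z K"
  shows "rooted_bound TYPE('w) U x"
proof -
  let ?A = "U - K" and ?B = "insert z K"
  obtain \<alpha> C where \<alpha>: "\<alpha> ` ?A \<subseteq> ?A" "\<alpha> x = x" "\<forall>v \<in> ?A. s (\<alpha> v) = s v"
    and C: "\<And>(W :: 'w set) c I q p. incidence_plane W c I q \<Longrightarrow>
        card (rooted_maps E s ?A x W c I p) * q ^ (card (map_prod \<alpha> \<alpha> ` (E \<inter> ?A \<times> ?A)) + 2)
          \<le> C * q ^ (2 * card (\<alpha> ` ?A))"
    using A unfolding rooted_bound_def by blast
  obtain \<beta> D where \<beta>: "\<beta> ` ?B \<subseteq> ?B" "\<beta> z = z" "\<forall>v \<in> ?B. s (\<beta> v) = s v"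
    and D: "\<And>(W :: 'w set) c I q p. incidence_plane W c I q \<Longrightarrow>
        card (rooted_maps E s ?B z W c I p) * q ^ (card (map_prod \<beta> \<beta> ` (E \<inter> ?B \<times> ?B)) + 2)
          \<le> D * q ^ (2 * card (\<beta> ` ?B))"
    using B unfolding rooted_bound_def by blast
  \<comment> \<open>\<open>\<beta>\<close> fixes \<open>z\<close>, while \<open>\<alpha>\<close> may
    move it to another vertex of \<open>U - K\<close>. Renaming \<open>z\<close> to
    \<open>\<alpha> z\<close> in the image of \<open>\<beta>\<close> makes the two collapses agree
    on \<open>z\<close>.\<close>
  define h where "h w = (if w = z then \<alpha> z else w)" for w
  define \<pi> where "\<pi> v = (if v \<in> K then h (\<beta> v) else \<alpha> v)" for v
  have \<pi>A: "\<pi> v = \<alpha> v" if "v \<in> ?A" for v using that by (simp add: \<pi>_def)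
  have \<pi>B: "\<pi> v = h (\<beta> v)" if "v \<in> ?B" for v using that K(4) \<beta>(2) by (auto simp: \<pi>_def h_def)
  have UAB: "U = ?A \<union> ?B" using K by blast
  have finB: "finite ?B" using K(1) fin finite_subset by auto
  let ?eA = "card (map_prod \<alpha> \<alpha> ` (E \<inter> ?A \<times> ?A))" and ?eB = "card (map_prod \<beta> \<beta> ` (E \<inter> ?B \<times> ?B))"
  let ?e = "card (map_prod \<pi> \<pi> ` (E \<inter> U \<times> U))"
  have split: "E \<inter> U \<times> U = E \<inter> ?A \<times> ?A \<union> E \<inter> ?B \<times> ?B"
  proof -
    have "v \<in> ?B" if "(u, v) \<in> E" "u \<in> K" "v \<in> U" for u v
      using cut[of u] that by (auto simp: nbr_def)
    moreover have "u \<in> ?B" if "(u, v) \<in> E" "v \<in> K" "u \<in> U" for u v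
      using cut[of v] that by (auto simp: nbr_def)
    ultimately show ?thesis using K(1,4) by blast
  qed
  have e: "?e \<le> ?eA + ?eB"
  proof -
    have 1: "map_prod \<pi> \<pi> ` (E \<inter> ?A \<times> ?A) = map_prod \<alpha> \<alpha> ` (E \<inter> ?A \<times> ?A)"
      by (intro image_cong) (auto simp: \<pi>A)
    have 2: "map_prod \<pi> \<pi> ` (E \<inter> ?B \<times> ?B) = map_prod h h ` map_prod \<beta> \<beta> ` (E \<inter> ?B \<times> ?B)"
      unfolding image_image by (intro image_cong) (auto simp: \<pi>B)
    have "finite (E \<inter> ?B \<times> ?B)" using finB by auto
    then have "card (map_prod h h ` map_prod \<beta> \<beta> ` (E \<inter> ?B \<times> ?B)) \<le> ?eB"
      by (intro card_image_le finite_imageI)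
    then show ?thesis
      unfolding split image_Un 1 2 by (intro order_trans[OF card_Un_le] add_left_mono)
  qed
  have im: "\<pi> ` U = \<alpha> ` ?A \<union> (\<beta> ` ?B - {z})"
  proof -
    have "\<pi> ` U = \<pi> ` ?A \<union> \<pi> ` ?B" using UAB by blast
    also have "\<pi> ` ?A = \<alpha> ` ?A" by (intro image_cong) (auto simp: \<pi>A)
    also have "\<pi> ` ?B = h ` \<beta> ` ?B" unfolding image_image by (intro image_cong) (auto simp: \<pi>B)
    also have "h ` \<beta> ` ?B = insert (\<alpha> z) (\<beta> ` ?B - {z})"
    proof -
      have "z \<in> \<beta> ` ?B" using \<beta>(2) by (metis imageI insertI1)
      then have "\<beta> ` ?B = insert z (\<beta> ` ?B - {z})" by blast
      then have "h ` \<beta> ` ?B = insert (h z) (h ` (\<beta> ` ?B - {z}))" by (metis image_insert)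
      also have "h ` (\<beta> ` ?B - {z}) = \<beta> ` ?B - {z}" by (force simp: h_def)
      finally show ?thesis by (simp add: h_def)
    qed
    finally show ?thesis using K(4) by auto
  qed
  have ck: "card (\<pi> ` U) + 1 = card (\<alpha> ` ?A) + card (\<beta> ` ?B)"
  proof -
    have "card (\<pi> ` U) = card (\<alpha> ` ?A) + card (\<beta> ` ?B - {z})"
      unfolding im using \<alpha>(1) \<beta>(1) fin finB by (intro card_Un_disjoint) auto
    moreover have "z \<in> \<beta> ` ?B" using \<beta>(2) by (metis imageI insertI1)
    then have "card (\<beta> ` ?B) = Suc (card (\<beta> ` ?B - {z}))"
      using finB by (metis card.remove finite_imageI)
    ultimately show ?thesis by simp
  qed
  have "card (rooted_maps E s U x W c I p) * q ^ (?e + 2) \<le> (C * D) * q ^ (2 * card (\<pi> ` U))"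
    if P: "incidence_plane W c I q" for W :: "'w set" and c I q p
  proof -
    interpret incidence_plane W c I q by fact
    let ?R = "rooted_maps E s U x W c I p" and ?RA = "rooted_maps E s ?A x W c I p"
    have fibre: "card {\<phi> \<in> ?R. restrict \<phi> ?A = \<psi>} * q ^ (?eB + 2) \<le> D * q ^ (2 * card (\<beta> ` ?B))"
      if "\<psi> \<in> ?RA" for \<psi>
    proof -
      let ?F = "{\<phi> \<in> ?R. restrict \<phi> ?A = \<psi>}"
      have "inj_on (\<lambda>\<phi>. restrict \<phi> ?B) ?F"
      proof (rule inj_onI)
        fix \<phi> \<phi>' assume a: "\<phi> \<in> ?F" "\<phi>' \<in> ?F" "restrict \<phi> ?B = restrict \<phi>' ?B"
        then have "\<phi> \<in> extensional U" "\<phi>' \<in> extensional U"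
          by (auto simp: rooted_maps_def colour_maps_def PiE_iff)
        moreover have "\<phi> v = \<phi>' v" if "v \<in> U" for v
        proof (cases "v \<in> ?A")
          case True
          have "restrict \<phi> ?A v = restrict \<phi>' ?A v" using a(1,2) by simp
          then show ?thesis using True by simp
        next
          case False
          then have "v \<in> ?B" using that by blast
          then show ?thesis using fun_cong[OF a(3), of v] by simp
        qed
        ultimately show "\<phi> = \<phi>'" by (rule extensionalityI)
      qed
      moreover have "(\<lambda>\<phi>. restrict \<phi> ?B) ` ?F \<subseteq> rooted_maps E s ?B z W c I (\<psi> z)"
      proof
        fix \<chi> assume "\<chi> \<in> (\<lambda>\<phi>. restrict \<phi> ?B) ` ?F"
        then obtain \<phi> where \<phi>: "\<phi> \<in> ?R" "restrict \<phi> ?A = \<psi>" "\<chi> = restrict \<phi> ?B" by blast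
        have "\<psi> z = \<phi> z" using \<phi>(2) K(4) by auto
        moreover have "?B \<subseteq> U" using K by blast
        ultimately show "\<chi> \<in> rooted_maps E s ?B z W c I (\<psi> z)"
          using rooted_restrict[OF \<phi>(1), of ?B z] \<phi>(3) by simp
      qed
      ultimately have "card ?F \<le> card (rooted_maps E s ?B z W c I (\<psi> z))"
        using finite_rooted_maps[OF finB finite_W] by (rule card_inj_on_le)
      then show ?thesis
        by (intro order_trans[OF mult_le_mono1 D[OF P, of "\<psi> z"]])
    qed
    have "(\<lambda>\<phi>. restrict \<phi> ?A) ` ?R \<subseteq> ?RA"
    proof
      fix \<chi> assume "\<chi> \<in> (\<lambda>\<phi>. restrict \<phi> ?A) ` ?R"
      then obtain \<phi> where \<phi>: "\<phi> \<in> ?R" "\<chi> = restrict \<phi> ?A" by blast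
      show "\<chi> \<in> ?RA" using rooted_restrict[OF \<phi>(1), of ?A x] rooted_root[OF \<phi>(1)] \<phi>(2) K by simp
    qed
    then have 1: "card ?R * q ^ (?eB + 2) \<le> card ?RA * (D * q ^ (2 * card (\<beta> ` ?B)))"
      using fin by (intro card_le_weighted_fibres[OF finite_rooted_maps[OF _ finite_W] _ fibre]) auto
    \<comment> \<open>The extra q^2 balances both sides: the two pieces contribute a
      \<open>+ 2\<close> each on the left, and on the right the image of \<open>z\<close> is counted
      in both pieces.\<close>
    have "card ?R * q ^ (?e + 2) * q\<^sup>2 = card ?R * q ^ (?e + 4)"
      by (simp only: mult.assoc power_add[symmetric] add.assoc) simp
    also have "\<dots> \<le> card ?R * q ^ (?eB + 2 + (?eA + 2))"
      using e q_pos by (intro mult_le_mono2 power_increasing) auto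
    also have "\<dots> = (card ?R * q ^ (?eB + 2)) * q ^ (?eA + 2)" by (simp only: power_add mult.assoc)
    also have "\<dots> \<le> (card ?RA * (D * q ^ (2 * card (\<beta> ` ?B)))) * q ^ (?eA + 2)"
      by (rule mult_le_mono1[OF 1])
    also have "\<dots> = (card ?RA * q ^ (?eA + 2)) * (D * q ^ (2 * card (\<beta> ` ?B)))" by (simp only: ac_simps)
    also have "\<dots> \<le> (C * q ^ (2 * card (\<alpha> ` ?A))) * (D * q ^ (2 * card (\<beta> ` ?B)))"
      by (rule mult_le_mono1[OF C[OF P]])
    also have "\<dots> = (C * D) * q ^ (2 * (card (\<alpha> ` ?A) + card (\<beta> ` ?B)))"
      by (simp only: power_add distrib_left ac_simps)
    also have "\<dots> = (C * D) * q ^ (2 * card (\<pi> ` U)) * q\<^sup>2"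
      unfolding ck[symmetric] by (simp only: power_add distrib_left mult_1_right mult.assoc)
    finally show ?thesis using q_pos by simp
  qed
  moreover have "\<pi> ` U \<subseteq> U" unfolding im using \<alpha>(1) \<beta>(1) K by blast
  moreover have "\<pi> x = x" using \<pi>A \<alpha>(2) K by simp
  moreover have "\<forall>v \<in> U. s (\<pi> v) = s v"
  proof
    fix v assume v: "v \<in> U"
    have sh: "s (h w) = s w" for w using \<alpha>(3) K(4) by (simp add: h_def)
    show "s (\<pi> v) = s v" using v \<alpha>(3) \<beta>(3) sh by (cases "v \<in> K") (auto simp: \<pi>_def)
  qed
  ultimately show ?thesis unfolding rooted_bound_def by blast
qed

text \<open>With m = |U| - 1, one of the two orders has g lost degrees of freedom with 2 g >= 3 m -
  1, so there are at most C q^(2 m - g) maps. The larger class \<open>K\<close> has 2 |K| >= m + 1,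
  hence 2 m - g <= |K|. Collapsing the other class to one vertex leaves |K| + 1 vertices and at most
  |K| edges, so its exponent is at least |K| + 2, where 2 belongs to the root.\<close>

lemma rooted_bound_st:
  assumes fin: "finite U" and x: "x \<in> U"
    and deg: "\<And>y. y \<in> U - {x} \<Longrightarrow> 3 \<le> card (nbr E U y)"
    and r: "st_rank U x t r" and xt: "x \<noteq> t"
  shows "rooted_bound TYPE('w) U x"
proof -
  have t: "t \<in> U" using r by (simp add: st_rank_def)
  \<comment> \<open>the reversed order, except that the root \<open>x\<close> still comes first\<close>
  define r' where "r' v = (if v = x then - r t - 1 else - r v)" for v
  let ?a = "\<lambda>v. min 2 (card {u \<in> nbr E U v. r u < r v})"
  let ?b = "\<lambda>v. min 2 (card {u \<in> nbr E U v. r' u < r' v})"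
  let ?m = "card (U - {x})"
  have finN: "finite (nbr E U v)" for v using fin by (simp add: nbr_def)
  have noloop: "v \<notin> nbr E U v" for v using nbr_col by blast
  \<comment> \<open>All neighbours of \<open>t\<close> precede it in the order \<open>r\<close>. In
    the reversed order no lower bound is claimed for \<open>t\<close>, so together it contributes 2
    rather than 3; this is the \<open>+ 1\<close> in \<open>sum\<close>.\<close>
  have gt: "2 \<le> ?a t"
  proof -
    have "{u \<in> nbr E U t. r u < r t} = nbr E U t"
      using r noloop[of t] by (auto simp: st_rank_def nbr_def)
    then show ?thesis using deg[of t] t xt by simp
  qed
  have gv: "3 \<le> ?a v + ?b v" if v: "v \<in> U - {x, t}" for v
  proof -
    let ?L = "{u \<in> nbr E U v. r u < r v}" and ?H = "{u \<in> nbr E U v. r v < r u}"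
    have "nbr E U v = ?L \<union> ?H"
    proof -
      have "r u \<noteq> r v" if "u \<in> nbr E U v" for u
        using r that v noloop[of v] by (auto simp: st_rank_def nbr_def inj_on_def)
      then show ?thesis by (auto simp: neq_iff)
    qed
    moreover have "card (?L \<union> ?H) = card ?L + card ?H"
      using finN by (intro card_Un_disjoint) auto
    ultimately have "3 \<le> card ?L + card ?H" using deg[of v] v by simp
    moreover have "?L \<noteq> {}" "?H \<noteq> {}" using r v unfolding st_rank_def by blast+
    then have "1 \<le> card ?L" "1 \<le> card ?H"
      using finN by (simp_all add: Suc_le_eq card_gt_0_iff)
    \<comment> \<open>Reversal turns upper neighbours into predecessors. The root cannot be among
      the upper neighbours, because it is the minimum of \<open>r\<close>.\<close>
    moreover have "card ?H \<le> card {u \<in> nbr E U v. r' u < r' v}"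
    proof (rule card_mono)
      have "r x < r v" using r v by (auto simp: st_rank_def)
      then show "?H \<subseteq> {u \<in> nbr E U v. r' u < r' v}" using v by (auto simp: r'_def)
    qed (use finN in auto)
    ultimately show ?thesis by linarith
  qed
  have Ux: "U - {x} = insert t (U - {x, t})" using t xt by auto
  have m: "?m = Suc (card (U - {x, t}))" unfolding Ux using fin by simp
  have "3 * card (U - {x, t}) \<le> (\<Sum>v\<in>U - {x, t}. ?a v + ?b v)"
    using sum_bounded_below[of "U - {x, t}" 3 "\<lambda>v. ?a v + ?b v"] gv by simp
  moreover have "(\<Sum>v\<in>U - {x}. ?a v + ?b v) = ?a t + ?b t + (\<Sum>v\<in>U - {x, t}. ?a v + ?b v)"
    unfolding Ux using fin by (subst sum.insert) auto
  ultimately have sum: "3 * ?m \<le> (\<Sum>v\<in>U - {x}. ?a v) + (\<Sum>v\<in>U - {x}. ?b v) + 1"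
    using gt m by (simp add: sum.distrib)
  have A: "\<exists>C. \<forall>(W :: 'w set) c I q p. incidence_plane W c I q \<longrightarrow>
     card (rooted_maps E s U x W c I p) * q ^ (\<Sum>v\<in>U - {x}. ?a v) \<le> C * q ^ (2 * ?m)"
    by (rule rooted_rank_bound[OF fin x])
  have B: "\<exists>C. \<forall>(W :: 'w set) c I q p. incidence_plane W c I q \<longrightarrow>
     card (rooted_maps E s U x W c I p) * q ^ (\<Sum>v\<in>U - {x}. ?b v) \<le> C * q ^ (2 * ?m)"
    by (rule rooted_rank_bound[OF fin x])
  obtain g C where g: "3 * ?m \<le> 2 * g + 1" and C: "\<And>(W :: 'w set) c I q p. incidence_plane W c I q \<Longrightarrow>
     card (rooted_maps E s U x W c I p) * q ^ g \<le> C * q ^ (2 * ?m)"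
  proof (cases "3 * ?m \<le> 2 * (\<Sum>v\<in>U - {x}. ?a v) + 1")
    case True
    then show thesis using A that by blast
  next
    case False
    then have "3 * ?m \<le> 2 * (\<Sum>v\<in>U - {x}. ?b v) + 1" using sum by linarith
    then show thesis using B that by blast
  qed
  obtain k where k: "card U \<le> 2 * card {v \<in> U. s v = k}"
  proof -
    have "U = {v \<in> U. s v = True} \<union> {v \<in> U. s v = False}" by auto
    then have "card U \<le> card {v \<in> U. s v = True} + card {v \<in> U. s v = False}"
      by (metis card_Un_le)
    then show thesis using that[of True] that[of False] by linarith
  qed
  define K where "K = {v \<in> U. s v = k}"
  define L where "L = {v \<in> U. s v \<noteq> k}"
  \<comment> \<open>The representative of the collapsed class must exist: either \<open>t\<close>
    itself lies in \<open>L\<close>, or one of its neighbours does.\<close>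
  have "L \<noteq> {}"
  proof (cases "s t = k")
    case True
    have "nbr E U t \<noteq> {}" using deg[of t] t xt by auto
    then obtain u where "u \<in> nbr E U t" by blast
    then have "u \<in> L" using nbr_col[of u U t] True by (auto simp: L_def nbr_def)
    then show ?thesis by blast
  qed (use t in \<open>auto simp: L_def\<close>)
  \<comment> \<open>The collapse has to fix the root, so \<open>x\<close> is the representative
    whenever it lies in the class that is identified.\<close>
  then obtain l where l: "l \<in> L" "x \<in> L \<Longrightarrow> l = x" by (cases "x \<in> L") auto
  define \<pi> where "\<pi> v = (if v \<in> L then l else v)" for v
  have lU: "l \<in> U" "s l \<noteq> k" using l by (auto simp: L_def)
  have im: "\<pi> ` U = insert l K"
    using l(1) by (auto simp: \<pi>_def K_def L_def image_iff)
  have finK: "finite K" using fin by (simp add: K_def)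
  have ck: "card (\<pi> ` U) = Suc (card K)"
    unfolding im using lU finK by (simp add: K_def)
  let ?e = "card (map_prod \<pi> \<pi> ` (E \<inter> U \<times> U))"
  have "map_prod \<pi> \<pi> ` (E \<inter> U \<times> U) \<subseteq> (\<lambda>v. if k then (v, l) else (l, v)) ` K"
    using edge_col by (fastforce simp: \<pi>_def K_def L_def image_iff)
  then have e: "?e \<le> card K"
    using finK by (meson card_image_le card_mono finite_imageI le_trans)
  have mU: "card U = Suc ?m" using fin x by (metis card.remove)
  have "card (rooted_maps E s U x W c I p) * q ^ (?e + 2) \<le> C * q ^ (2 * card (\<pi> ` U))"
    if P: "incidence_plane W c I q" for W :: "'w set" and c I q p
  proof -
    interpret incidence_plane W c I q by fact
    let ?R = "card (rooted_maps E s U x W c I p)"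
    have "2 * ?m \<le> card K + g" using g k mU unfolding K_def by linarith
    then have "?R * q ^ g \<le> C * q ^ (card K + g)"
      using q_pos by (intro order_trans[OF C[OF P]] mult_le_mono2 power_increasing) auto
    then have R: "?R \<le> C * q ^ card K" using q_pos by (simp add: power_add)
    have "?R * q ^ (?e + 2) \<le> ?R * q ^ (card K + 2)"
      using e q_pos by (intro mult_le_mono2 power_increasing) auto
    also have "\<dots> \<le> (C * q ^ card K) * q ^ (card K + 2)" by (rule mult_le_mono1[OF R])
    also have "\<dots> = C * q ^ (2 * card (\<pi> ` U))"
      unfolding ck by (simp only: mult.assoc power_add[symmetric]) (simp add: mult_2)
    finally show ?thesis .
  qed
  moreover have "\<pi> ` U \<subseteq> U" unfolding im using lU by (auto simp: K_def)
  moreover have "\<pi> x = x" using l(2) by (simp add: \<pi>_def)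
  moreover have "\<forall>v \<in> U. s (\<pi> v) = s v" using lU by (auto simp: \<pi>_def L_def)
  ultimately show ?thesis unfolding rooted_bound_def by blast
qed

text \<open>Strong induction on |U|: a non-root vertex of degree at most 2 is peeled off, and
  otherwise \<open>st_rank_or_cut\<close> yields either a numbering or a cut vertex at which the set
  splits into two smaller ones.\<close>

theorem rooted_bound:
  assumes "finite U" "x \<in> U"
  shows "rooted_bound TYPE('w) U x"
  using assms
proof (induction "card U" arbitrary: U x rule: less_induct)
  case less
  show ?case
  proof (cases "U = {x}")
    case True then show ?thesis by (simp add: rooted_bound_singleton)
  next
    case False
    then obtain t where t: "t \<in> U" "x \<noteq> t" using less.prems by blast
    show ?thesis
    proof (cases "\<exists>y \<in> U - {x}. card (nbr E U y) \<le> 2")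
      case True
      then obtain y where y: "y \<in> U" "y \<noteq> x" "card (nbr E U y) \<le> 2" by blast
      have "rooted_bound TYPE('w) (U - {y}) x"
        using less.prems y by (intro less.hyps psubset_card_mono) auto
      moreover have "card (nbr E (U - {y}) y) \<le> 2"
        using y(3) less.prems by (intro order_trans[OF card_mono y(3)]) (auto simp: nbr_def)
      ultimately have "rooted_bound TYPE('w) (insert y (U - {y})) x"
        using less.prems y by (intro rooted_bound_insert) auto
      then show ?thesis using y(1) by (simp add: insert_absorb)
    next
      case False
      have deg: "3 \<le> card (nbr E U y)" if "y \<in> U - {x}" for y
      proof -
        have "\<not> card (nbr E U y) \<le> 2" using False that by blast
        then show ?thesis by simp
      qed
      from st_rank_or_cut[OF less.prems t] show ?thesis
      proof (elim disjE exE conjE)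
        fix r assume "st_rank U x t r"
        then show ?thesis by (intro rooted_bound_st[OF less.prems deg _ t(2)])
      next
        fix K z assume K: "K \<noteq> {}" "K \<subseteq> U" "x \<notin> K" "t \<notin> K" "z \<in> U - K" "\<forall>v \<in> K. nbr E U v \<subseteq> insert z K"
        have "rooted_bound TYPE('w) (U - K) x"
          using less.prems K(1-3) by (intro less.hyps psubset_card_mono) auto
        moreover have "rooted_bound TYPE('w) (insert z K) z"
        proof (intro less.hyps psubset_card_mono)
          \<comment> \<open>Both \<open>x\<close> and \<open>t\<close> lie outside \<open>K\<close>
            and only one of them can equal \<open>z\<close>, so this piece is a proper subset and
            the induction hypothesis applies.\<close>
          have "\<not> {x, t} \<subseteq> insert z K" using K(3,4) t(2) by blast
          then show "insert z K \<subset> U" using K(2,5) t(1) less.prems(2) by blast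
          show "finite (insert z K)" using K(2) less.prems(1) finite_subset by auto
        qed (use less.prems in auto)
        ultimately show ?thesis
          using less.prems K(2,3,5,6) by (intro rooted_bound_cut[of U K x z]) auto
      qed
    qed
  qed
qed

text \<open>A self-map of \<open>U\<close> represents the collapse that identifies the vertices with equal image.\<close>

definition self_maps :: "'v set \<Rightarrow> ('v \<Rightarrow> 'v) set" where
  "self_maps U = {r \<in> U \<rightarrow>\<^sub>E U. (\<forall>v \<in> U. s (r v) = s v)}"

lemma finite_self_maps: "finite U \<Longrightarrow> finite (self_maps U)"
  unfolding self_maps_def by (rule finite_subset[of _ "U \<rightarrow>\<^sub>E U"]) (auto intro: finite_PiE)

lemma coloured_graph_image:
  assumes "r \<in> self_maps U"
  shows "coloured_graph (map_prod r r ` (E \<inter> U \<times> U)) s"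
  using assms edge_col by unfold_locales (auto simp: self_maps_def)

section \<open>Factoring maps through collapses\<close>

text \<open>\<open>r\<close> sends each vertex to a chosen representative of its fibre under
  \<open>\<phi>\<close>. On the representatives \<open>\<phi>\<close> is injective, and it is
  constant along the fibres.\<close>

lemma maps_factor:
  assumes "\<phi> \<in> colour_maps E s U W c I"
  shows "\<exists>r \<in> self_maps U. \<exists>\<psi> \<in> colour_maps (map_prod r r ` (E \<inter> U \<times> U)) s (r ` U) W c I.
    inj_on \<psi> (r ` U) \<and> \<phi> = restrict (\<psi> \<circ> r) U"
proof -
  define r where "r = restrict (\<lambda>v. SOME u. u \<in> U \<and> \<phi> u = \<phi> v) U"
  have r: "r v \<in> U \<and> \<phi> (r v) = \<phi> v" if "v \<in> U" for v
  proof -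
    have "\<exists>u. u \<in> U \<and> \<phi> u = \<phi> v" using that by blast
    then have "(SOME u. u \<in> U \<and> \<phi> u = \<phi> v) \<in> U \<and> \<phi> (SOME u. u \<in> U \<and> \<phi> u = \<phi> v) = \<phi> v"
      by (rule someI_ex)
    then show ?thesis using that by (simp add: r_def)
  qed
  have r_eq: "r u = r v" if "u \<in> U" "v \<in> U" "\<phi> u = \<phi> v" for u v
    using that by (simp add: r_def)
  have phi: "\<phi> \<in> extensional U" "\<And>v. v \<in> U \<Longrightarrow> \<phi> v \<in> W" "\<And>v. v \<in> U \<Longrightarrow> c (\<phi> v) = s v"
    "\<And>u v. u \<in> U \<Longrightarrow> v \<in> U \<Longrightarrow> (u, v) \<in> E \<Longrightarrow> I (\<phi> u) (\<phi> v)"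
    using assms by (auto simp: colour_maps_def PiE_iff)
  have rret: "r \<in> self_maps U"
  proof -
    have "s (r v) = s v" if "v \<in> U" for v
      using phi(3)[of v] phi(3)[of "r v"] r[OF that] that by simp
    moreover have "r \<in> extensional U" by (simp add: r_def)
    ultimately show ?thesis using r by (auto simp: self_maps_def PiE_iff)
  qed
  let ?\<psi> = "restrict \<phi> (r ` U)"
  have \<psi>: "?\<psi> (r v) = \<phi> v" if "v \<in> U" for v
    using r[OF that] that by simp
  have "inj_on ?\<psi> (r ` U)"
  proof (rule inj_onI, elim imageE)
    fix a b u v assume "?\<psi> a = ?\<psi> b" "a = r u" "u \<in> U" "b = r v" "v \<in> U"
    then show "a = b" using \<psi>[of u] \<psi>[of v] r_eq[of u v] by metis
  qed
  moreover have "\<phi> = restrict (?\<psi> \<circ> r) U"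
  proof (rule extensionalityI[OF phi(1)])
    show "\<phi> v = restrict (?\<psi> \<circ> r) U v" if "v \<in> U" for v using \<psi>[OF that] that by simp
  qed simp
  moreover have "?\<psi> \<in> colour_maps (map_prod r r ` (E \<inter> U \<times> U)) s (r ` U) W c I"
  proof -
    have A: "?\<psi> a \<in> W \<and> c (?\<psi> a) = s a" if a: "a \<in> r ` U" for a
    proof -
      obtain v where v: "v \<in> U" "a = r v" using a by blast
      have "s (r v) = s v" using rret v(1) by (simp add: self_maps_def)
      then show ?thesis using phi(2,3)[OF v(1)] unfolding v(2) \<psi>[OF v(1)] by simp
    qed
    have B: "I (?\<psi> a) (?\<psi> b)" if ab: "(a, b) \<in> map_prod r r ` (E \<inter> U \<times> U)" for a b
    proof -
      obtain u v where uv: "u \<in> U" "v \<in> U" "(u, v) \<in> E" "a = r u" "b = r v" using ab by auto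
      show ?thesis unfolding uv(4,5) \<psi>[OF uv(1)] \<psi>[OF uv(2)] by (rule phi(4)[OF uv(1-3)])
    qed
    show ?thesis
      unfolding colour_maps_def PiE_iff mem_Collect_eq
      by (intro conjI ballI impI A[THEN conjunct1] A[THEN conjunct2] B restrict_extensional)
  qed
  ultimately show ?thesis using rret by blast
qed

text \<open>The quantity 2 |V| - |E| of the collapse given by \<open>\<pi>\<close>. It is an integer
  because it may be negative for dense graphs.\<close>

definition exponent :: "'v set \<Rightarrow> ('v \<Rightarrow> 'v) \<Rightarrow> int" where
  "exponent U \<pi> = 2 * int (card (\<pi> ` U)) - int (card (map_prod \<pi> \<pi> ` (E \<inter> U \<times> U)))"

text \<open>The rooted bound is summed over the at most 2 q^2 images of one root, which uses up the
  \<open>+ 2\<close> in the exponent.\<close>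

lemma injective_bound:
  assumes "finite U" "U \<noteq> {}"
  shows "\<exists>\<pi> \<in> self_maps U. \<exists>C. \<forall>(W :: 'w set) c I q. incidence_plane W c I q \<longrightarrow>
    card {\<phi> \<in> colour_maps E s U W c I. inj_on \<phi> U} * q ^ card (map_prod \<pi> \<pi> ` (E \<inter> U \<times> U))
      \<le> C * q ^ (2 * card (\<pi> ` U))"
proof -
  obtain x where x: "x \<in> U" using assms(2) by blast
  obtain \<pi> C where \<pi>: "\<pi> ` U \<subseteq> U" "\<forall>v \<in> U. s (\<pi> v) = s v" and
    C: "\<And>(W :: 'w set) c I q p. incidence_plane W c I q \<Longrightarrow>
        card (rooted_maps E s U x W c I p) * q ^ (card (map_prod \<pi> \<pi> ` (E \<inter> U \<times> U)) + 2)
          \<le> C * q ^ (2 * card (\<pi> ` U))"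
    using rooted_bound[OF assms(1) x, where ?'w = 'w] unfolding rooted_bound_def by blast
  define \<rho> where "\<rho> = restrict \<pi> U"
  have \<rho>: "\<rho> \<in> self_maps U" using \<pi> by (auto simp: \<rho>_def self_maps_def)
  have eq: "\<rho> ` U = \<pi> ` U" "map_prod \<rho> \<rho> ` (E \<inter> U \<times> U) = map_prod \<pi> \<pi> ` (E \<inter> U \<times> U)"
    by (auto simp: \<rho>_def intro!: image_cong)
  have "card {\<phi> \<in> colour_maps E s U W c I. inj_on \<phi> U} * q ^ card (map_prod \<rho> \<rho> ` (E \<inter> U \<times> U))
      \<le> (2 * C) * q ^ (2 * card (\<rho> ` U))" if P: "incidence_plane W c I q" for W :: "'w set" and c I q
  proof -
    interpret incidence_plane W c I q by fact
    let ?A = "{\<phi> \<in> colour_maps E s U W c I. inj_on \<phi> U}" and ?B = "{w \<in> W. c w = s x}"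
    let ?e = "card (map_prod \<pi> \<pi> ` (E \<inter> U \<times> U))"
    have fib: "{\<phi> \<in> ?A. \<phi> x = p} = rooted_maps E s U x W c I p" for p
      by (auto simp: rooted_maps_def)
    have "card ?A * q ^ (?e + 2) \<le> card ?B * (C * q ^ (2 * card (\<pi> ` U)))"
    proof (rule card_le_weighted_fibres)
      show "finite ?B" using finite_W by simp
      show "(\<lambda>\<phi>. \<phi> x) ` ?A \<subseteq> ?B" using x by (auto simp: colour_maps_def)
      show "card {\<phi> \<in> ?A. \<phi> x = p} * q ^ (?e + 2) \<le> C * q ^ (2 * card (\<pi> ` U))" for p
        unfolding fib by (rule C[OF P])
    qed
    also have "\<dots> \<le> (2 * q\<^sup>2) * (C * q ^ (2 * card (\<pi> ` U)))"
      by (rule mult_le_mono1[OF class_le])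
    finally have "(card ?A * q ^ ?e) * q\<^sup>2 \<le> ((2 * C) * q ^ (2 * card (\<pi> ` U))) * q\<^sup>2"
      by (simp only: power_add ac_simps)
    then show ?thesis unfolding eq using q_pos by simp
  qed
  then show ?thesis using \<rho> by blast
qed

text \<open>By \<open>maps_factor\<close> each map is an injective map of one of finitely many
  quotients of \<open>U\<close>. Each quotient is handled by \<open>injective_bound\<close>, and the
  constants are added up.\<close>

theorem maps_upper_bound:
  assumes fin: "finite U" and ne: "U \<noteq> {}" and m: "\<And>\<pi>. \<pi> \<in> self_maps U \<Longrightarrow> exponent U \<pi> \<le> m"
  shows "\<exists>C. \<forall>(W :: 'w set) c I q. incidence_plane W c I q \<longrightarrow>
     real (card (colour_maps E s U W c I)) \<le> real C * real q powi m"
proof -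
  let ?E = "\<lambda>r. map_prod r r ` (E \<inter> U \<times> U)"
  let ?Inj = "\<lambda>r (W :: 'w set) c I. {\<psi> \<in> colour_maps (?E r) s (r ` U) W c I. inj_on \<psi> (r ` U)}"
  have "\<exists>C. \<forall>(W :: 'w set) c I q. incidence_plane W c I q \<longrightarrow>
     real (card (?Inj r W c I)) \<le> real C * real q powi m" if r: "r \<in> self_maps U" for r
  proof -
    interpret r: coloured_graph "?E r" s using r by (rule coloured_graph_image)
    have fin_r: "finite (r ` U)" "r ` U \<noteq> {}" using fin ne by auto
    from r.injective_bound[OF fin_r, where ?'w = 'w] obtain \<pi> C where \<pi>: "\<pi> \<in> r.self_maps (r ` U)"
      and C0: "\<forall>(W :: 'w set) c I q. incidence_plane W c I q \<longrightarrow>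
        card (?Inj r W c I) * q ^ card (map_prod \<pi> \<pi> ` (?E r \<inter> r ` U \<times> r ` U))
          \<le> C * q ^ (2 * card (\<pi> ` r ` U))"
      by (elim bexE exE)
    note C = C0[rule_format]
    \<comment> \<open>A collapse of a collapse is again a collapse of \<open>U\<close>, so its
      exponent is covered by \<open>m\<close>.\<close>
    define \<rho> where "\<rho> = restrict (\<pi> \<circ> r) U"
    have "\<rho> \<in> self_maps U"
    proof -
      have "\<pi> (r v) \<in> U \<and> s (\<pi> (r v)) = s v" if "v \<in> U" for v
      proof -
        have "r v \<in> U" "s (r v) = s v" using r that by (auto simp: self_maps_def)
        moreover have "\<pi> (r v) \<in> r ` U" "s (\<pi> (r v)) = s (r v)" using \<pi> that by (auto simp: self_maps_def)
        ultimately show ?thesis using r by (auto simp: self_maps_def)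
      qed
      then show ?thesis by (simp add: \<rho>_def self_maps_def)
    qed
    then have dm: "exponent U \<rho> \<le> m" by (rule m)
    have eq: "\<pi> ` r ` U = \<rho> ` U" "map_prod \<pi> \<pi> ` (?E r \<inter> r ` U \<times> r ` U) = ?E \<rho>"
    proof -
      show "\<pi> ` r ` U = \<rho> ` U" unfolding image_image by (intro image_cong) (auto simp: \<rho>_def)
      have "?E r \<inter> r ` U \<times> r ` U = ?E r" by auto
      then show "map_prod \<pi> \<pi> ` (?E r \<inter> r ` U \<times> r ` U) = ?E \<rho>"
        by (simp only: image_image) (intro image_cong, auto simp: \<rho>_def)
    qed
    have "real (card (?Inj r W c I)) \<le> real C * real q powi m" if P: "incidence_plane W c I q"
      for W :: "'w set" and c I q
    proof -
      interpret incidence_plane W c I q by fact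
      have "real (card (?Inj r W c I)) * real q ^ card (?E \<rho>) \<le> real C * real q ^ (2 * card (\<rho> ` U))"
        using of_nat_mono[OF C[OF P], where 'a = real] unfolding eq of_nat_mult of_nat_power .
      then have "real (card (?Inj r W c I)) \<le> real C * real q ^ (2 * card (\<rho> ` U)) / real q ^ card (?E \<rho>)"
        using q_pos by (simp add: field_simps)
      also have "\<dots> = real C * real q powi exponent U \<rho>"
        using q_pos by (simp add: exponent_def power_int_diff flip: power_int_of_nat)
      also have "\<dots> \<le> real C * real q powi m"
        using dm q_pos by (intro mult_left_mono power_int_increasing) auto
      finally show ?thesis .
    qed
    then show ?thesis by blast
  qed
  then have "\<forall>r \<in> self_maps U. \<exists>C. \<forall>(W :: 'w set) c I q. incidence_plane W c I q \<longrightarrow>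
     real (card (?Inj r W c I)) \<le> real C * real q powi m" by (rule ballI)
  from bchoice[OF this] obtain C where C: "\<And>r (W :: 'w set) c I q. r \<in> self_maps U \<Longrightarrow> incidence_plane W c I q \<Longrightarrow>
     real (card (?Inj r W c I)) \<le> real (C r) * real q powi m"
    by blast
  have "real (card (colour_maps E s U W c I)) \<le> real (\<Sum>r\<in>self_maps U. C r) * real q powi m"
    if P: "incidence_plane W c I q" for W :: "'w set" and c I q
  proof -
    interpret incidence_plane W c I q by fact
    have finI: "finite (?Inj r W c I)" for r
      by (rule finite_subset[OF _ finite_colour_maps[OF finite_imageI[OF fin] finite_W]]) auto
    have "colour_maps E s U W c I \<subseteq> (\<Union>r\<in>self_maps U. (\<lambda>\<psi>. restrict (\<psi> \<circ> r) U) ` ?Inj r W c I)"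
    proof
      fix \<phi> assume "\<phi> \<in> colour_maps E s U W c I"
      from maps_factor[OF this] show "\<phi> \<in> (\<Union>r\<in>self_maps U. (\<lambda>\<psi>. restrict (\<psi> \<circ> r) U) ` ?Inj r W c I)"
        by blast
    qed
    then have "card (colour_maps E s U W c I) \<le> card (\<Union>r\<in>self_maps U. (\<lambda>\<psi>. restrict (\<psi> \<circ> r) U) ` ?Inj r W c I)"
      using finite_self_maps[OF fin] finI by (intro card_mono finite_UN_I finite_imageI)
    also have "\<dots> \<le> (\<Sum>r\<in>self_maps U. card ((\<lambda>\<psi>. restrict (\<psi> \<circ> r) U) ` ?Inj r W c I))"
      by (rule card_UN_le[OF finite_self_maps[OF fin]])
    also have "\<dots> \<le> (\<Sum>r\<in>self_maps U. card (?Inj r W c I))"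
      by (intro sum_mono card_image_le finI)
    finally have "real (card (colour_maps E s U W c I)) \<le> (\<Sum>r\<in>self_maps U. real (card (?Inj r W c I)))"
      using of_nat_mono[where 'a = real] by fastforce
    also have "\<dots> \<le> (\<Sum>r\<in>self_maps U. real (C r) * real q powi m)"
      by (intro sum_mono C P)
    finally show ?thesis by (simp add: sum_distrib_right)
  qed
  then show ?thesis by blast
qed

subsection \<open>Lower bound\<close>

lemma card_edges_insert:
  assumes "finite U" "y \<notin> U"
  shows "card (E \<inter> insert y U \<times> insert y U) = card (E \<inter> U \<times> U) + card (nbr E U y)"
proof -
  let ?F = "(\<lambda>u. if s y then (y, u) else (u, y)) ` nbr E U y"
  have "card ?F = card (nbr E U y)" by (rule card_image) (auto simp: inj_on_def)
  moreover have "finite ?F" "(E \<inter> U \<times> U) \<inter> ?F = {}"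
    using assms by (auto simp: nbr_def split: if_splits)
  ultimately show ?thesis
    unfolding edges_insert[OF assms(2)] using assms(1) by (subst card_Un_disjoint) auto
qed

text \<open>The counterpart of \<open>rooted_extend\<close> for arbitrary maps: with 0, 1 or 2
  neighbours there are at least q^2, q or 1 choices for \<open>y\<close>. Two neighbours have the
  same colour and may have the same image; \<open>common_exists\<close> covers both cases.\<close>

lemma maps_extend:
  assumes P: "incidence_plane W c I q" and fin: "finite U" and y: "y \<notin> U" and d: "card (nbr E U y) \<le> 2"
  shows "card (colour_maps E s U W c I) * q\<^sup>2 \<le> card (colour_maps E s (insert y U) W c I) * q ^ card (nbr E U y)"
proof (rule card_ge_weighted_fibres[where f = "\<lambda>\<phi>. restrict \<phi> U"])
  interpret incidence_plane W c I q by fact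
  let ?N = "nbr E U y"
  show "finite (colour_maps E s (insert y U) W c I)" "finite (colour_maps E s U W c I)"
    using fin finite_W by (auto intro: finite_colour_maps)
  show "(\<lambda>\<phi>. restrict \<phi> U) ` colour_maps E s (insert y U) W c I \<subseteq> colour_maps E s U W c I"
    by (auto intro: maps_restrict)
  fix \<psi> assume \<psi>: "\<psi> \<in> colour_maps E s U W c I"
  let ?F = "{\<phi> \<in> colour_maps E s (insert y U) W c I. restrict \<phi> U = \<psi>}"
  let ?W = "{w \<in> W. c w = s y \<and> (\<forall>u \<in> ?N. I (\<psi> u) w)}"
  have \<psi>u: "\<psi> u \<in> W" "c (\<psi> u) = s u" if "u \<in> U" for u
    using \<psi> that by (auto simp: colour_maps_def)
  have finN: "finite ?N" using fin by (simp add: nbr_def)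
  have sub: "(\<lambda>w. \<psi>(y := w)) ` ?W \<subseteq> ?F"
  proof
    fix \<phi> assume "\<phi> \<in> (\<lambda>w. \<psi>(y := w)) ` ?W"
    then obtain w where w: "w \<in> W" "c w = s y" "\<And>u. u \<in> ?N \<Longrightarrow> I (\<psi> u) w" "\<phi> = \<psi>(y := w)" by blast
    have yy: "(y, y) \<notin> E" using edge_col by blast
    have "I (\<phi> u) (\<phi> v)" if uv: "u \<in> insert y U" "v \<in> insert y U" "(u, v) \<in> E" for u v
    proof -
      consider "u = y" "v \<in> U" "v \<noteq> y" | "v = y" "u \<in> U" "u \<noteq> y" | "u \<in> U" "v \<in> U" "u \<noteq> y" "v \<noteq> y"
        using uv yy y by blast
      then show ?thesis
      proof cases
        case 1
        then have "v \<in> ?N" using uv by (auto simp: nbr_def)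
        then show ?thesis using 1 I_sym[OF w(3)] w(4) by simp
      next
        case 2
        then have "u \<in> ?N" using uv by (auto simp: nbr_def)
        then show ?thesis using 2 w(3,4) by simp
      next
        case 3
        then show ?thesis using \<psi> uv(3) w(4) by (auto simp: colour_maps_def)
      qed
    qed
    moreover have "\<phi> \<in> insert y U \<rightarrow>\<^sub>E W" using \<psi> w by (auto simp: colour_maps_def PiE_iff extensional_def)
    moreover have "\<forall>v \<in> insert y U. c (\<phi> v) = s v" using \<psi>u w by auto
    moreover have "restrict \<phi> U = \<psi>"
    proof (rule extensionalityI[of _ U])
      show "\<psi> \<in> extensional U" using \<psi> by (simp add: colour_maps_def PiE_iff)
      show "restrict \<phi> U v = \<psi> v" if "v \<in> U" for v using that w(4) y by auto
    qed simp
    ultimately show "\<phi> \<in> ?F" by (simp add: colour_maps_def)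
  qed
  have "inj_on (\<lambda>w. \<psi>(y := w)) ?W" by (rule inj_onI) (metis fun_upd_same)
  moreover have "finite ?F"
    by (rule finite_subset[OF _ finite_colour_maps[of "insert y U" W E s c I]]) (use fin finite_W in auto)
  ultimately have WF: "card ?W \<le> card ?F" using sub by (intro card_inj_on_le)
  consider "?N = {}" | u where "?N = {u}" | u v where "?N = {u, v}" "u \<noteq> v"
  proof -
    have "card ?N = 0 \<or> card ?N = 1 \<or> card ?N = 2" using d by linarith
    then show thesis
    proof (elim disjE)
      assume "card ?N = 0" then show thesis using that(1) finN by simp
    next
      assume "card ?N = 1" then show thesis using that(2) by (auto simp: card_1_singleton_iff)
    next
      assume "card ?N = 2" then show thesis using that(3) by (auto simp: card_2_iff)
    qed
  qed
  then have "q\<^sup>2 \<le> card ?W * q ^ card ?N"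
  proof cases
    case 1
    then show ?thesis using class_ge[of "s y"] by simp
  next
    case 2
    have u: "u \<in> U" "s u \<noteq> s y" using 2 nbr_col[of u U y] by (auto simp: nbr_def)
    have "{w. I (\<psi> u) w} \<subseteq> ?W"
      using 2 I_W[OF I_sym] I_col[of "\<psi> u"] \<psi>u(2)[OF u(1)] u(2) by auto
    then have "q \<le> card ?W"
      using deg_ge[OF \<psi>u(1)[OF u(1)]] finite_W by (auto intro: order_trans[OF _ card_mono])
    then show ?thesis using 2 by (simp add: power2_eq_square)
  next
    case 3
    have u: "u \<in> U" "s u \<noteq> s y" using 3 nbr_col[of u U y] by (auto simp: nbr_def)
    have v: "v \<in> U" "s v \<noteq> s y" using 3 nbr_col[of v U y] by (auto simp: nbr_def)
    obtain w where w: "I (\<psi> u) w" "I (\<psi> v) w"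
      using common_exists[of "\<psi> u" "\<psi> v"] \<psi>u u v by auto
    then have "w \<in> ?W"
      using 3 I_W[OF I_sym[OF w(1)]] I_col[OF w(1)] \<psi>u(2)[OF u(1)] u(2) by auto
    then have "1 \<le> card ?W" using finite_W by (auto simp: Suc_le_eq card_gt_0_iff)
    moreover have "card ?N = 2" using 3 by simp
    ultimately show ?thesis using mult_le_mono1[of 1 "card ?W" "q\<^sup>2"] by simp
  qed
  also have "\<dots> \<le> card ?F * q ^ card ?N" by (rule mult_le_mono1[OF WF])
  finally show "q\<^sup>2 \<le> card ?F * q ^ card ?N" .
qed

text \<open>Peeling off vertices of degree at most 2 leads down to the empty set, which has exactly
  one map. Adding them back by \<open>maps_extend\<close> loses no constant factor.\<close>

lemma maps_lower_degenerate:
  assumes P: "incidence_plane W c I q" and fin: "finite U"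
    and deg: "\<And>S. S \<subseteq> U \<Longrightarrow> S \<noteq> {} \<Longrightarrow> \<exists>y \<in> S. card (nbr E S y) \<le> 2"
  shows "q ^ (2 * card U) \<le> card (colour_maps E s U W c I) * q ^ card (E \<inter> U \<times> U)"
  using fin deg
proof (induction "card U" arbitrary: U)
  case 0
  then have U: "U = {}" by simp
  have "colour_maps E s {} W c I = {\<lambda>_. undefined}" by (auto simp: colour_maps_def)
  then show ?case by (simp add: U)
next
  case (Suc n)
  then have "U \<noteq> {}" by auto
  then obtain y where y: "y \<in> U" "card (nbr E U y) \<le> 2" using Suc.prems(2)[of U] by blast
  define T where "T = U - {y}"
  have T: "U = insert y T" "y \<notin> T" "finite T" using y(1) Suc.prems(1) by (auto simp: T_def)
  have nb: "nbr E U y = nbr E T y"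
    using edge_col unfolding T(1) nbr_def by blast
  have IH: "q ^ (2 * card T) \<le> card (colour_maps E s T W c I) * q ^ card (E \<inter> T \<times> T)"
    using Suc.hyps T by (intro Suc.hyps(1) Suc.prems(2)) auto
  have ext: "card (colour_maps E s T W c I) * q\<^sup>2 \<le> card (colour_maps E s U W c I) * q ^ card (nbr E T y)"
    using maps_extend[OF P T(3,2)] y(2) unfolding nb T(1)[symmetric] by simp
  have "q ^ (2 * card U) = q ^ (2 * card T) * q\<^sup>2"
    unfolding T(1) using T(2,3) by (simp add: power2_eq_square)
  also have "\<dots> \<le> (card (colour_maps E s T W c I) * q ^ card (E \<inter> T \<times> T)) * q\<^sup>2"
    by (rule mult_le_mono1[OF IH])
  also have "\<dots> = (card (colour_maps E s T W c I) * q\<^sup>2) * q ^ card (E \<inter> T \<times> T)" by (simp only: ac_simps)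
  also have "\<dots> \<le> (card (colour_maps E s U W c I) * q ^ card (nbr E T y)) * q ^ card (E \<inter> T \<times> T)"
    by (rule mult_le_mono1[OF ext])
  also have "\<dots> = card (colour_maps E s U W c I) * q ^ card (E \<inter> U \<times> U)"
    unfolding T(1) card_edges_insert[OF T(3,2)] by (simp only: power_add ac_simps)
  finally show ?case .
qed

text \<open>Let \<open>K\<close> be the larger and \<open>L\<close> the smaller class of
  \<open>S\<close>. Since \<open>S\<close> spans at least 3 |K| edges and at most |K| survive the
  identification of \<open>L\<close>, at least 2 |K| edges disappear, at the price of |L| - 1 <= |K|
  - 1 vertices. So 2 |V| - |E| grows by at least 2.\<close>

lemma collapse_core:
  assumes fin: "finite U" and S: "S \<subseteq> U" "S \<noteq> {}" and deg: "\<And>y. y \<in> S \<Longrightarrow> 3 \<le> card (nbr E S y)"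
  shows "\<exists>g \<in> self_maps U. 2 * int (card U) - int (card (E \<inter> U \<times> U)) < exponent U g"
proof -
  have finS: "finite S" using S(1) fin finite_subset by blast
  have "\<exists>k. card {v \<in> S. s v \<noteq> k} \<le> card {v \<in> S. s v = k}"
    by (cases "card {v \<in> S. s v} \<le> card {v \<in> S. \<not> s v}") (auto intro: exI[of _ True] exI[of _ False])
  then obtain k where k: "card {v \<in> S. s v \<noteq> k} \<le> card {v \<in> S. s v = k}" ..
  define K where "K = {v \<in> S. s v = k}"
  define L where "L = {v \<in> S. s v \<noteq> k}"
  have finKL: "finite K" "finite L" using finS by (auto simp: K_def L_def)
  have "K \<noteq> {}"
  proof
    assume K0: "K = {}"
    moreover have "card L \<le> card K" using k by (simp add: K_def L_def)
    ultimately have "L = {}" using finKL by simp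
    with K0 S(2) show False by (auto simp: K_def L_def)
  qed
  then obtain v0 where v0: "v0 \<in> K" by blast
  then have "nbr E S v0 \<noteq> {}" using deg[of v0] by (auto simp: K_def)
  then obtain l where "l \<in> nbr E S v0" by blast
  then have l: "l \<in> L" using v0 nbr_col[of l S v0] by (auto simp: K_def L_def nbr_def)
  define g where "g = (\<lambda>v \<in> U. if v \<in> L then l else v)"
  have LU: "L \<subseteq> U" and KU: "K \<subseteq> U" using S(1) by (auto simp: L_def K_def)
  have lU: "l \<in> U" using l LU by blast
  have gret: "g \<in> self_maps U" using l lU by (auto simp: self_maps_def g_def L_def)
  have im: "g ` U = insert l (U - L)" using l LU by (auto simp: g_def image_iff)
  have "card (g ` U) = Suc (card (U - L))" unfolding im using l fin by simp
  moreover have "card (U - L) + card L = card U"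
    using fin LU by (metis card_Diff_subset card_mono finKL(2) le_add_diff_inverse2)
  ultimately have cU: "card (g ` U) + card L = Suc (card U)" by simp
  let ?EU = "E \<inter> U \<times> U" and ?ES = "E \<inter> S \<times> S"
  have finE: "finite ?EU" "finite ?ES" using fin finS by auto
  have sub: "?ES \<subseteq> ?EU" using S(1) by blast
  have "3 * card K \<le> card ?ES"
  proof -
    let ?f = "\<lambda>(v, u). if k then (v, u) else (u, v)"
    have "3 * card K \<le> (\<Sum>v\<in>K. card (nbr E S v))"
      using sum_bounded_below[of K 3 "\<lambda>v. card (nbr E S v)"] deg by (simp add: K_def)
    also have "\<dots> = card (Sigma K (nbr E S))"
      using finKL finS by (subst card_SigmaI) (auto simp: nbr_def)
    also have "\<dots> = card (?f ` Sigma K (nbr E S))"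
      by (rule card_image[symmetric]) (auto simp: inj_on_def)
    also have "?f ` Sigma K (nbr E S) \<subseteq> ?ES"
      using edge_col by (fastforce simp: K_def nbr_def)
    then have "card (?f ` Sigma K (nbr E S)) \<le> card ?ES" using finE by (intro card_mono)
    finally show ?thesis .
  qed
  moreover have "card (map_prod g g ` ?EU) \<le> card (map_prod g g ` ?ES) + card (map_prod g g ` (?EU - ?ES))"
  proof -
    have "map_prod g g ` ?EU = map_prod g g ` ?ES \<union> map_prod g g ` (?EU - ?ES)" using sub by blast
    then show ?thesis by (simp only: card_Un_le)
  qed
  moreover have "card (map_prod g g ` (?EU - ?ES)) + card ?ES \<le> card ?EU"
  proof -
    have "card (map_prod g g ` (?EU - ?ES)) \<le> card (?EU - ?ES)" using finE by (intro card_image_le) auto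
    moreover have "card (?EU - ?ES) + card ?ES = card ?EU"
      using finE sub by (metis card_Diff_subset card_mono le_add_diff_inverse2)
    ultimately show ?thesis by linarith
  qed
  moreover have "card (map_prod g g ` ?ES) \<le> card K"
  proof -
    have "map_prod g g ` ?ES \<subseteq> (\<lambda>v. if k then (v, l) else (l, v)) ` K"
    proof
      fix e assume "e \<in> map_prod g g ` ?ES"
      then obtain u v where uv: "u \<in> S" "v \<in> S" "(u, v) \<in> E" "e = (g u, g v)" by auto
      have c: "s u" "\<not> s v" using edge_col[OF uv(3)] by auto
      show "e \<in> (\<lambda>v. if k then (v, l) else (l, v)) ` K"
        using uv c S(1) by (cases k) (auto simp: g_def K_def L_def image_iff)
    qed
    then have "card (map_prod g g ` ?ES) \<le> card ((\<lambda>v. if k then (v, l) else (l, v)) ` K)"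
      using finKL(1) by (intro card_mono finite_imageI)
    also have "\<dots> \<le> card K" by (rule card_image_le[OF finKL(1)])
    finally show ?thesis .
  qed
  ultimately have "card (map_prod g g ` ?EU) + 2 * card K \<le> card ?EU" by linarith
  then have "2 * int (card U) - int (card ?EU) < exponent U g"
    using cU k unfolding exponent_def K_def[symmetric] L_def[symmetric] by linarith
  then show ?thesis using gret by blast
qed

text \<open>If the image of an optimal \<open>\<pi>\<close> contained a part of minimum degree at
  least 3, then composing with \<open>collapse_core\<close> would improve on \<open>\<pi>\<close>.
  So the image is degenerate, and its maps pull back injectively along \<open>\<pi>\<close> to maps
  of \<open>U\<close>.\<close>

lemma maps_lower_bound:
  assumes P: "incidence_plane W c I q" and fin: "finite U" and \<pi>: "\<pi> \<in> self_maps U"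
    and max: "\<And>\<rho>. \<rho> \<in> self_maps U \<Longrightarrow> exponent U \<rho> \<le> exponent U \<pi>"
  shows "real q powi exponent U \<pi> \<le> real (card (colour_maps E s U W c I))"
proof -
  interpret incidence_plane W c I q by fact
  define F where "F = map_prod \<pi> \<pi> ` (E \<inter> U \<times> U)"
  interpret F: coloured_graph F s unfolding F_def using \<pi> by (rule coloured_graph_image)
  have F: "F \<inter> \<pi> ` U \<times> \<pi> ` U = F" by (auto simp: F_def)
  have degen: "\<exists>y \<in> S. card (nbr F S y) \<le> 2" if S: "S \<subseteq> \<pi> ` U" "S \<noteq> {}" for S
  proof (rule ccontr)
    assume "\<not> ?thesis"
    then have "3 \<le> card (nbr F S y)" if "y \<in> S" for y using that by force
    then obtain g where g: "g \<in> self_maps (\<pi> ` U)" "2 * int (card (\<pi> ` U)) - int (card F) < F.exponent (\<pi> ` U) g"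
      using F.collapse_core[OF finite_imageI[OF fin] S] unfolding F by blast
    define \<rho> where "\<rho> = restrict (g \<circ> \<pi>) U"
    have "g (\<pi> v) \<in> U \<and> s (g (\<pi> v)) = s v" if "v \<in> U" for v
    proof -
      have "\<pi> v \<in> U" "s (\<pi> v) = s v" using \<pi> that by (auto simp: self_maps_def)
      moreover have "g (\<pi> v) \<in> \<pi> ` U" "s (g (\<pi> v)) = s (\<pi> v)" using g(1) that by (auto simp: self_maps_def)
      ultimately show ?thesis using \<pi> by (auto simp: self_maps_def)
    qed
    then have "\<rho> \<in> self_maps U" by (simp add: \<rho>_def self_maps_def)
    moreover have "F.exponent (\<pi> ` U) g = exponent U \<rho>"
    proof -
      have "g ` \<pi> ` U = \<rho> ` U" unfolding image_image by (intro image_cong) (auto simp: \<rho>_def)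
      moreover have "map_prod g g ` F = map_prod \<rho> \<rho> ` (E \<inter> U \<times> U)"
        unfolding F_def image_image by (intro image_cong) (auto simp: \<rho>_def)
      ultimately show ?thesis unfolding F.exponent_def exponent_def F by simp
    qed
    moreover have "exponent U \<pi> = 2 * int (card (\<pi> ` U)) - int (card F)"
      by (simp add: exponent_def F_def)
    ultimately show False using max[of \<rho>] g(2) by simp
  qed
  have "q ^ (2 * card (\<pi> ` U)) \<le> card (colour_maps F s (\<pi> ` U) W c I) * q ^ card (F \<inter> \<pi> ` U \<times> \<pi> ` U)"
  proof (rule F.maps_lower_degenerate[OF P])
    show "finite (\<pi> ` U)" using fin by simp
    show "\<exists>y \<in> S. card (nbr F S y) \<le> 2" if "S \<subseteq> \<pi> ` U" "S \<noteq> {}" for S using that by (rule degen)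
  qed
  also have "F \<inter> \<pi> ` U \<times> \<pi> ` U = F" by (rule F)
  also have "card (colour_maps F s (\<pi> ` U) W c I) \<le> card (colour_maps E s U W c I)"
  proof (rule card_inj_on_le)
    show "inj_on (\<lambda>\<psi>. restrict (\<psi> \<circ> \<pi>) U) (colour_maps F s (\<pi> ` U) W c I)"
    proof (rule inj_onI)
      fix \<psi> \<chi> assume a: "\<psi> \<in> colour_maps F s (\<pi> ` U) W c I" "\<chi> \<in> colour_maps F s (\<pi> ` U) W c I"
        "restrict (\<psi> \<circ> \<pi>) U = restrict (\<chi> \<circ> \<pi>) U"
      have "\<psi> (\<pi> v) = \<chi> (\<pi> v)" if "v \<in> U" for v using fun_cong[OF a(3), of v] that by simp
      then show "\<psi> = \<chi>" using a(1,2) by (intro extensionalityI[of _ "\<pi> ` U"]) (auto simp: colour_maps_def PiE_iff)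
    qed
    show "(\<lambda>\<psi>. restrict (\<psi> \<circ> \<pi>) U) ` colour_maps F s (\<pi> ` U) W c I \<subseteq> colour_maps E s U W c I"
    proof
      fix \<phi> assume "\<phi> \<in> (\<lambda>\<psi>. restrict (\<psi> \<circ> \<pi>) U) ` colour_maps F s (\<pi> ` U) W c I"
      then obtain \<psi> where \<psi>: "\<psi> \<in> colour_maps F s (\<pi> ` U) W c I" "\<phi> = restrict (\<psi> \<circ> \<pi>) U" by blast
      have "(\<pi> u, \<pi> v) \<in> F" if "u \<in> U" "v \<in> U" "(u, v) \<in> E" for u v
        using that by (force simp: F_def)
      moreover have "s (\<pi> v) = s v" if "v \<in> U" for v using \<pi> that by (simp add: self_maps_def)
      ultimately show "\<phi> \<in> colour_maps E s U W c I"
        using \<psi> by (auto simp: colour_maps_def)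
    qed
    show "finite (colour_maps E s U W c I)" by (rule finite_colour_maps[OF fin finite_W])
  qed
  finally have "q ^ (2 * card (\<pi> ` U)) \<le> card (colour_maps E s U W c I) * q ^ card F" by simp
  from of_nat_mono[OF this, where 'a = real]
  have "real q ^ (2 * card (\<pi> ` U)) \<le> real (card (colour_maps E s U W c I)) * real q ^ card F"
    unfolding of_nat_mult of_nat_power .
  then have "real q ^ (2 * card (\<pi> ` U)) / real q ^ card F \<le> real (card (colour_maps E s U W c I))"
    using q_pos by (simp add: field_simps)
  then show ?thesis
    using q_pos by (simp add: exponent_def F_def power_int_diff flip: power_int_of_nat)
qed

end

section \<open>The projective plane over a finite field\<close>

text \<open>Coordinates with respect to a basis are unique; a finite basis exists because the finite
  carrier generates itself.\<close>

lemma (in vectorspace) card_carrier: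
  assumes "finite (carrier V)"
  shows "card (carrier V) = card (carrier K) ^ dim"
proof -
  have "gen_set (carrier V)"
    using in_own_span[of "carrier V"] span_is_subset2[of "carrier V"] by auto
  then have "fin_dim" using assms by (auto simp: fin_dim_def)
  then obtain B where B: "finite B" "basis B" using finite_basis_exists by blast
  have BV: "B \<subseteq> carrier V" using B(2) by (simp add: basis_def)
  have ex1: "\<And>v. v \<in> carrier V \<Longrightarrow> \<exists>!a. a \<in> B \<rightarrow>\<^sub>E carrier K \<and> lincomb a B = v"
    using basis_criterion[OF B(1) BV] B(2) by blast
  have "bij_betw (\<lambda>a. lincomb a B) (B \<rightarrow>\<^sub>E carrier K) (carrier V)"
  proof (rule bij_betw_imageI)
    have cl: "lincomb a B \<in> carrier V" if "a \<in> B \<rightarrow>\<^sub>E carrier K" for a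
      using that BV by (intro lincomb_closed) (auto simp: PiE_iff)
    show "inj_on (\<lambda>a. lincomb a B) (B \<rightarrow>\<^sub>E carrier K)"
    proof (rule inj_onI)
      fix a b assume "a \<in> B \<rightarrow>\<^sub>E carrier K" "b \<in> B \<rightarrow>\<^sub>E carrier K" "lincomb a B = lincomb b B"
      then show "a = b" using ex1[OF cl[of b]] by blast
    qed
    show "(\<lambda>a. lincomb a B) ` (B \<rightarrow>\<^sub>E carrier K) = carrier V"
      using cl ex1 by blast
  qed
  then have "card (carrier V) = card (B \<rightarrow>\<^sub>E carrier K)" using bij_betw_same_card by fastforce
  also have "\<dots> = card (carrier K) ^ card B" using B(1) by (simp add: card_PiE)
  finally show ?thesis using dim_basis[OF B] by simp
qed

locale finite_space3 = vectorspace K V for K :: "('a, 'k) ring_scheme" and V :: "('a, 'c, 'd) module_scheme" +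
  fixes q :: nat
  assumes q_ge_2: "2 \<le> q" and card_K: "card (carrier K) = q" and card_V: "card (carrier V) = q ^ 3"
begin

text \<open>Dimension is encoded by cardinality, which turns the geometry into counting;
  \<open>subs_iff_dim\<close> gives the equivalence with the usual dimension.\<close>

definition subs :: "nat \<Rightarrow> 'c set set" where
  "subs d = {W. submodule K W V \<and> card W = q ^ d}"

lemma finite_V: "finite (carrier V)"
  using card_V q_ge_2 by (intro card_ge_0_finite) simp

lemma subs_le: "W \<in> subs d \<Longrightarrow> W \<subseteq> carrier V"
  by (simp add: subs_def submodule_def)

lemma finite_sub: "submodule K W V \<Longrightarrow> finite W"
  using finite_V by (auto simp: submodule_def intro: finite_subset)

lemma finite_subs: "finite (subs d)"
  by (rule finite_subset[of _ "Pow (carrier V)"]) (use finite_V subs_le in auto)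

lemma card_sub:
  assumes "submodule K W V"
  shows "card W = q ^ vectorspace.dim K (V\<lparr>carrier := W\<rparr>)"
proof -
  have "subspace K W V" using assms vectorspace_axioms by (simp add: subspace_def)
  then interpret W: vectorspace K "V\<lparr>carrier := W\<rparr>" by (rule subspace_is_vs)
  show ?thesis using W.card_carrier finite_sub[OF assms] card_K by simp
qed

lemma subs_iff_dim:
  "W \<in> subs d \<longleftrightarrow> subspace K W V \<and> vectorspace.dim K (V\<lparr>carrier := W\<rparr>) = d"
proof -
  have "submodule K W V \<longleftrightarrow> subspace K W V" using vectorspace_axioms by (simp add: subspace_def)
  then show ?thesis
    using card_sub[of W] q_ge_2 by (auto simp: subs_def)
qed

lemma q_pow_less: "q ^ a < q ^ b \<longleftrightarrow> a < b"
  using q_ge_2 by simp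

lemma q_pow_le: "q ^ a \<le> q ^ b \<longleftrightarrow> a \<le> b"
  using q_ge_2 by simp

text \<open>The size of a submodule is a power of q, so it is determined by an upper bound q^d and a
  strict lower bound q^(d - 1). The latter is multiplied by q to avoid the subtraction in the
  exponent.\<close>

lemma sub_between:
  assumes "submodule K W V" "card W \<le> q ^ d" "q ^ d < q * card W"
  shows "W \<in> subs d"
proof -
  obtain k where k: "card W = q ^ k" using card_sub[OF assms(1)] by blast
  have "k \<le> d" using assms(2) unfolding k q_pow_le .
  moreover have "d < Suc k" using assms(3) unfolding k power_Suc[symmetric] q_pow_less .
  ultimately have "k = d" by simp
  then show ?thesis using k assms(1) by (simp add: subs_def)
qed

lemma sub_inter: "submodule K A V \<Longrightarrow> submodule K B V \<Longrightarrow> submodule K (A \<inter> B) V"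
  by (auto simp: submodule_def)

lemma sub_minus:
  assumes "submodule K A V" "v \<in> A" "w \<in> A"
  shows "v \<ominus>\<^bsub>V\<^esub> w \<in> A"
proof -
  have "w \<in> carrier V" using assms by (auto simp: submodule_def)
  then have "\<ominus>\<^bsub>V\<^esub> w = (\<ominus>\<^bsub>K\<^esub> \<one>\<^bsub>K\<^esub>) \<odot>\<^bsub>V\<^esub> w" by (simp add: smult_minus_1)
  then show ?thesis using assms by (simp add: submodule_def a_minus_def)
qed

definition ray :: "'c \<Rightarrow> 'c set" where
  "ray v = (\<lambda>c. c \<odot>\<^bsub>V\<^esub> v) ` carrier K"

lemma self_ray: "v \<in> carrier V \<Longrightarrow> v \<in> ray v"
  unfolding ray_def by (rule image_eqI[of _ _ "\<one>\<^bsub>K\<^esub>"]) auto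

lemma ray_sub: "submodule K A V \<Longrightarrow> v \<in> A \<Longrightarrow> ray v \<subseteq> A"
  by (auto simp: ray_def submodule_def)

lemma ray_subs:
  assumes v: "v \<in> carrier V" "v \<noteq> \<zero>\<^bsub>V\<^esub>"
  shows "ray v \<in> subs 1"
proof (rule sub_between)
  show sub: "submodule K (ray v) V"
  proof (rule submodule.intro)
    show "module K V" by (rule module_axioms)
    show "ray v \<subseteq> carrier V" using v by (auto simp: ray_def)
    show "\<zero>\<^bsub>V\<^esub> \<in> ray v" unfolding ray_def
      by (rule image_eqI[of _ _ "\<zero>\<^bsub>K\<^esub>"]) (use v in auto)
    fix a b assume "a \<in> ray v" "b \<in> ray v"
    then obtain c d where cd: "c \<in> carrier K" "d \<in> carrier K" "a = c \<odot>\<^bsub>V\<^esub> v" "b = d \<odot>\<^bsub>V\<^esub> v"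
      by (auto simp: ray_def)
    then show "a \<oplus>\<^bsub>V\<^esub> b \<in> ray v" unfolding ray_def
      by (intro image_eqI[of _ _ "c \<oplus>\<^bsub>K\<^esub> d"]) (use v in \<open>auto simp: smult_l_distr\<close>)
  next
    fix a b assume "a \<in> carrier K" "b \<in> ray v"
    then obtain d where cd: "d \<in> carrier K" "b = d \<odot>\<^bsub>V\<^esub> v" "a \<in> carrier K"
      by (auto simp: ray_def)
    then show "a \<odot>\<^bsub>V\<^esub> b \<in> ray v" unfolding ray_def
      by (intro image_eqI[of _ _ "a \<otimes>\<^bsub>K\<^esub> d"]) (use v in \<open>auto simp: smult_assoc1\<close>)
  qed
  have "finite (carrier K)" using card_K q_ge_2 by (intro card_ge_0_finite) simp
  then show "card (ray v) \<le> q ^ 1"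
    using card_K card_image_le[of "carrier K" "\<lambda>c. c \<odot>\<^bsub>V\<^esub> v"] by (simp add: ray_def)
  \<comment> \<open>Two distinct elements already rule out the size q^0.\<close>
  have "{\<zero>\<^bsub>V\<^esub>, v} \<subseteq> ray v" using self_ray v(1) sub by (simp add: submodule_def)
  then have "card {\<zero>\<^bsub>V\<^esub>, v} \<le> card (ray v)" using finite_sub[OF sub] by (rule card_mono[rotated])
  then have "2 \<le> card (ray v)" using v(2) by simp
  then show "q ^ 1 < q * card (ray v)" using q_ge_2 by simp
qed

lemma subs_eqI: "A \<in> subs d \<Longrightarrow> B \<in> subs d \<Longrightarrow> A \<subseteq> B \<Longrightarrow> A = B"
  by (rule card_subset_eq) (auto simp: subs_def finite_sub)

lemma ray_unique: "p \<in> subs 1 \<Longrightarrow> v \<in> p \<Longrightarrow> v \<noteq> \<zero>\<^bsub>V\<^esub> \<Longrightarrow> ray v = p"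
  using ray_subs[of v] subs_le[of p 1] ray_sub[of p v]
  by (intro subs_eqI[of _ 1]) (auto simp: subs_def)

section \<open>Joins, meets and numbers of points and lines\<close>

text \<open>The sum of the two points has at most q^2 elements and properly contains a point, so it
  has more than q.\<close>

lemma join_points:
  assumes p: "p \<in> subs 1" "p' \<in> subs 1" "p \<noteq> p'"
  shows "\<exists>l \<in> subs 2. p \<subseteq> l \<and> p' \<subseteq> l"
proof -
  have sp: "submodule K p V" "submodule K p' V" and cp: "card p = q" "card p' = q"
    using p by (auto simp: subs_def)
  let ?l = "submodule_sum p p'"
  have sub: "submodule K ?l V" by (rule sum_is_submodule[OF sp])
  have "p \<subseteq> ?l" by (rule in_sum[OF sp])
  moreover have "p' \<subseteq> ?l" using in_sum[OF sp(2,1)] msum_comm[OF sp] by simp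
  moreover have "?l \<in> subs 2"
  proof (rule sub_between[OF sub])
    have "{(x, y). x \<in> p \<and> y \<in> p'} = p \<times> p'" by auto
    then have "card ?l \<le> card (p \<times> p')"
      unfolding submodule_sum_def using sp finite_sub by (metis card_image_le finite_cartesian_product)
    then show "card ?l \<le> q ^ 2" using cp by (simp add: card_cartesian_product power2_eq_square)
    have "p \<subset> ?l" using calculation p subs_eqI[of p' 1 p] by blast
    then have "q < card ?l" using psubset_card_mono[OF finite_sub[OF sub]] cp by metis
    then show "q ^ 2 < q * card ?l" using q_ge_2 by (simp add: power2_eq_square)
  qed
  ultimately show ?thesis by blast
qed

text \<open>The intersection is smaller than a line. If it were trivial, addition would embed the
  product of the two lines, which has q^4 elements, into a space with q^3 elements.\<close>

lemma meet_lines: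
  assumes l: "l \<in> subs 2" "l' \<in> subs 2" "l \<noteq> l'"
  shows "l \<inter> l' \<in> subs 1"
proof -
  have sl: "submodule K l V" "submodule K l' V" and cl: "card l = q\<^sup>2" "card l' = q\<^sup>2"
    using l by (auto simp: subs_def)
  have sub: "submodule K (l \<inter> l') V" by (rule sub_inter[OF sl])
  obtain k where k: "card (l \<inter> l') = q ^ k" using card_sub[OF sub] by blast
  have "l \<inter> l' \<subset> l" using subs_eqI[of l 2 l'] l by blast
  then have "card (l \<inter> l') < card l" using finite_sub[OF sl(1)] by (rule psubset_card_mono[rotated])
  then have "k < 2" unfolding k cl q_pow_less .
  moreover have "k \<noteq> 0"
  proof
    assume "k = 0"
    then obtain z where z: "l \<inter> l' = {z}" using k by (auto simp: card_1_singleton_iff)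
    have zero: "w = \<zero>\<^bsub>V\<^esub>" if "w \<in> l \<inter> l'" for w
      using sub z that by (auto simp: submodule_def)
    have "inj_on (\<lambda>(a, b). a \<oplus>\<^bsub>V\<^esub> b) (l \<times> l')"
    proof (rule inj_onI, clarify)
      fix a b a' b' assume ab: "a \<in> l" "b \<in> l'" "a' \<in> l" "b' \<in> l'" "a \<oplus>\<^bsub>V\<^esub> b = a' \<oplus>\<^bsub>V\<^esub> b'"
      have c: "a \<in> carrier V" "b \<in> carrier V" "a' \<in> carrier V" "b' \<in> carrier V"
        using ab subs_le l by blast+
      have "b' = \<ominus>\<^bsub>V\<^esub> a' \<oplus>\<^bsub>V\<^esub> (a \<oplus>\<^bsub>V\<^esub> b)"
        unfolding ab(5) using c by (simp add: M.r_neg1)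
      then have "b' \<ominus>\<^bsub>V\<^esub> b = (\<ominus>\<^bsub>V\<^esub> a' \<oplus>\<^bsub>V\<^esub> a) \<oplus>\<^bsub>V\<^esub> (b \<oplus>\<^bsub>V\<^esub> \<ominus>\<^bsub>V\<^esub> b)"
        using c by (simp add: M.minus_eq M.a_assoc)
      then have e: "a \<ominus>\<^bsub>V\<^esub> a' = b' \<ominus>\<^bsub>V\<^esub> b"
        using c by (simp add: M.minus_eq M.r_neg M.a_comm)
      have "a \<ominus>\<^bsub>V\<^esub> a' \<in> l" "b' \<ominus>\<^bsub>V\<^esub> b \<in> l'" using sub_minus sl ab by auto
      then have "a \<ominus>\<^bsub>V\<^esub> a' = \<zero>\<^bsub>V\<^esub>" "b' \<ominus>\<^bsub>V\<^esub> b = \<zero>\<^bsub>V\<^esub>" using zero e by auto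
      moreover have "v = w" if "v \<ominus>\<^bsub>V\<^esub> w = \<zero>\<^bsub>V\<^esub>" "v \<in> carrier V" "w \<in> carrier V" for v w
      proof -
        have "v = (v \<ominus>\<^bsub>V\<^esub> w) \<oplus>\<^bsub>V\<^esub> w" using that(2,3) by (simp add: M.minus_eq M.a_assoc M.l_neg)
        then show ?thesis using that by simp
      qed
      ultimately show "a = a' \<and> b = b'" using c by metis
    qed
    moreover have "(\<lambda>(a, b). a \<oplus>\<^bsub>V\<^esub> b) ` (l \<times> l') \<subseteq> carrier V"
      using subs_le[OF l(1)] subs_le[OF l(2)] by auto
    ultimately have "card (l \<times> l') \<le> q ^ 3" using card_inj_on_le[OF _ _ finite_V] card_V by metis
    then have "q ^ 4 \<le> q ^ 3" using cl by (simp add: card_cartesian_product flip: power_add)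
    then show False unfolding q_pow_le by simp
  qed
  ultimately have "k = 1" by simp
  then show ?thesis using sub k by (simp add: subs_def)
qed

text \<open>The nonzero vectors of \<open>W\<close> are partitioned by the points that they span,
  with q - 1 vectors to each point.\<close>

lemma points_in:
  assumes W: "W \<in> subs d"
  shows "card {p \<in> subs 1. p \<subseteq> W} * (q - 1) = q ^ d - 1"
proof -
  have sW: "submodule K W V" and cW: "card W = q ^ d" using W by (auto simp: subs_def)
  have zW: "\<zero>\<^bsub>V\<^esub> \<in> W" if "submodule K W V" for W using that by (simp add: submodule_def)
  let ?P = "{p \<in> subs 1. p \<subseteq> W}"
  have "card (W - {\<zero>\<^bsub>V\<^esub>}) = (\<Sum>p\<in>?P. card {v \<in> W - {\<zero>\<^bsub>V\<^esub>}. ray v = p})"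
  proof -
    have "ray ` (W - {\<zero>\<^bsub>V\<^esub>}) \<subseteq> ?P"
      using ray_subs ray_sub[OF sW] subs_le[OF W] by blast
    then show ?thesis
      using sum.group[of "W - {\<zero>\<^bsub>V\<^esub>}" ?P ray "\<lambda>_. 1 :: nat"] finite_sub[OF sW] finite_subs by simp
  qed
  also have "\<dots> = (\<Sum>p\<in>?P. q - 1)"
  proof (rule sum.cong)
    fix p assume p: "p \<in> ?P"
    have "{v \<in> W - {\<zero>\<^bsub>V\<^esub>}. ray v = p} = p - {\<zero>\<^bsub>V\<^esub>}"
      using p ray_unique self_ray subs_le[OF W] by blast
    moreover have "submodule K p V" "card p = q" using p by (auto simp: subs_def)
    ultimately show "card {v \<in> W - {\<zero>\<^bsub>V\<^esub>}. ray v = p} = q - 1" using zW by simp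
  qed simp
  finally show ?thesis using zW[OF sW] cW by simp
qed

lemma carrier_subs: "carrier V \<in> subs 3"
  using card_V module_axioms by (simp add: subs_def submodule_def)

lemma points_on_line: "l \<in> subs 2 \<Longrightarrow> card {p \<in> subs 1. p \<subseteq> l} = q + 1"
proof -
  assume "l \<in> subs 2"
  from points_in[OF this] have "card {p \<in> subs 1. p \<subseteq> l} * (q - 1) = q\<^sup>2 - 1" .
  also have "\<dots> = (q + 1) * (q - 1)" by (cases q) (simp_all add: power2_eq_square)
  finally have "card {p \<in> subs 1. p \<subseteq> l} * (q - 1) = (q + 1) * (q - 1)" .
  then show ?thesis using q_ge_2 by (simp only: mult_cancel2) auto
qed

lemma card_points: "card (subs 1) = q\<^sup>2 + q + 1"
proof -
  have "{p \<in> subs 1. p \<subseteq> carrier V} = subs 1" using subs_le by blast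
  then have "card (subs 1) * (q - 1) = q ^ 3 - 1" using points_in[OF carrier_subs] by simp
  also have "\<dots> = (q\<^sup>2 + q + 1) * (q - 1)"
    by (cases q) (simp_all add: algebra_simps power2_eq_square power3_eq_cube)
  finally show ?thesis using q_ge_2 by (simp only: mult_cancel2) auto
qed

text \<open>The lines through \<open>p\<close> partition the q^3 - q vectors outside
  \<open>p\<close>: \<open>join_points\<close> shows that they cover them, and
  \<open>meet_lines\<close> that they overlap only in \<open>p\<close>. Each line contributes q^2 -
  q vectors.\<close>

lemma lines_on_point:
  assumes p: "p \<in> subs 1"
  shows "card {l \<in> subs 2. p \<subseteq> l} = q + 1"
proof -
  let ?L = "{l \<in> subs 2. p \<subseteq> l}"
  have finp: "finite p" and cp: "card p = q" and pV: "p \<subseteq> carrier V"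
    using p finite_sub subs_le[OF p] by (auto simp: subs_def)
  have "carrier V - p = (\<Union>l\<in>?L. l - p)"
  proof
    show "(\<Union>l\<in>?L. l - p) \<subseteq> carrier V - p" using subs_le by blast
    show "carrier V - p \<subseteq> (\<Union>l\<in>?L. l - p)"
    proof
      fix v assume v: "v \<in> carrier V - p"
      have "\<zero>\<^bsub>V\<^esub> \<in> p" using p by (simp add: subs_def submodule_def)
      then have v1: "ray v \<in> subs 1" using v by (intro ray_subs) auto
      have vv: "v \<in> ray v" using v self_ray by blast
      then have "ray v \<noteq> p" using v by blast
      then obtain l where "l \<in> subs 2" "ray v \<subseteq> l" "p \<subseteq> l" using join_points[OF v1 p] by blast
      then show "v \<in> (\<Union>l\<in>?L. l - p)" using v vv by blast
    qed
  qed
  moreover have "card (\<Union>l\<in>?L. l - p) = (\<Sum>l\<in>?L. card (l - p))"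
  proof (rule card_UN_disjoint)
    show "finite ?L" using finite_subs by simp
    show "\<forall>l\<in>?L. finite (l - p)" using finite_sub by (auto simp: subs_def)
    show "\<forall>l\<in>?L. \<forall>l'\<in>?L. l \<noteq> l' \<longrightarrow> (l - p) \<inter> (l' - p) = {}"
    proof (intro ballI impI)
      fix l l' assume l: "l \<in> ?L" "l' \<in> ?L" "l \<noteq> l'"
      have "p = l \<inter> l'" using l p meet_lines[of l l'] by (intro subs_eqI) auto
      then show "(l - p) \<inter> (l' - p) = {}" by blast
    qed
  qed
  moreover have "(\<Sum>l\<in>?L. card (l - p)) = (\<Sum>l\<in>?L. q\<^sup>2 - q)"
    using finp cp by (intro sum.cong) (auto simp: card_Diff_subset subs_def)
  moreover have "card (carrier V - p) = q ^ 3 - q"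
    using finp cp pV card_V by (simp add: card_Diff_subset)
  ultimately have "card ?L * (q\<^sup>2 - q) = q ^ 3 - q" by simp
  also have "\<dots> = (q + 1) * (q\<^sup>2 - q)"
    by (simp add: algebra_simps power2_eq_square power3_eq_cube)
  finally have "card ?L * (q\<^sup>2 - q) = (q + 1) * (q\<^sup>2 - q)" .
  moreover have "q < q\<^sup>2" using q_ge_2 by (simp add: power2_eq_square)
  ultimately show ?thesis by (simp only: mult_cancel2) auto
qed

text \<open>Double counting of incident pairs: every point and every line lies in q + 1 of
  them.\<close>

lemma card_lines: "card (subs 2) = q\<^sup>2 + q + 1"
proof -
  have "(\<Sum>p\<in>subs 1. card {l \<in> subs 2. p \<subseteq> l}) = (q + 1) * card (subs 2)"
    by (rule sum_multicount) (use finite_subs points_on_line in auto)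
  also have "(\<Sum>p\<in>subs 1. card {l \<in> subs 2. p \<subseteq> l}) = (q + 1) * card (subs 1)"
    by (simp add: lines_on_point)
  finally have "(q + 1) * card (subs 1) = (q + 1) * card (subs 2)" .
  then have "card (subs 1) = card (subs 2)" by (simp only: mult_cancel1) simp
  then show ?thesis using card_points by simp
qed

end

section \<open>Incidence graphs as incidence planes\<close>

definition incident :: "('a, 'b) bigraph \<Rightarrow> 'a + 'b \<Rightarrow> 'a + 'b \<Rightarrow> bool" where
  "incident G a b \<longleftrightarrow> (\<exists>u v. (u, v) \<in> edges G \<and> (a = Inl u \<and> b = Inr v \<or> a = Inr v \<and> b = Inl u))"

lemma incident_simps [simp]:
  "incident G (Inl u) (Inr v) \<longleftrightarrow> (u, v) \<in> edges G"
  "incident G (Inr v) (Inl u) \<longleftrightarrow> (u, v) \<in> edges G"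
  "\<not> incident G (Inl u) (Inl u')"
  "\<not> incident G (Inr v) (Inr v')"
  by (auto simp: incident_def)

lemma finite_space3_space3:
  assumes "field F" "order F = q" "2 \<le> q"
  shows "finite_space3 F (space3 F) q"
proof -
  interpret field F by fact
  have V: "vectorspace F (space3 F)"
    unfolding vectorspace_def space3_def using func_space_is_module field_axioms by blast
  have cF: "card (carrier F) = q" using assms(2) by (simp add: order_def)
  have "carrier (space3 F) = {..<3} \<rightarrow>\<^sub>E carrier F" by (simp add: space3_def func_space_def)
  then have "card (carrier (space3 F)) = q ^ 3" using cF by (simp add: card_PiE)
  then show ?thesis using V cF assms(3) by (simp add: finite_space3_def finite_space3_axioms_def)
qed

lemma subspaces3_eq:
  assumes "finite_space3 F (space3 F) q"
  shows "subspaces3 F d = finite_space3.subs F (space3 F) q d"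
  using finite_space3.subs_iff_dim[OF assms] by (auto simp: subspaces3_def)

lemma incidence_plane_incidence_graph:
  assumes "field F" "order F = q" "2 \<le> q"
  defines "G \<equiv> incidence_graph F"
  shows "incidence_plane (verts1 G <+> verts2 G) isl (incident G) q"
    and "card (verts1 G) = q\<^sup>2 + q + 1" and "card (verts2 G) = q\<^sup>2 + q + 1"
proof -
  interpret finite_space3 F "space3 F" q by (rule finite_space3_space3[OF assms(1-3)])
  have G: "verts1 G = subs 1" "verts2 G = subs 2"
    "edges G = {(p, l). p \<in> subs 1 \<and> l \<in> subs 2 \<and> p \<subseteq> l}"
    unfolding G_def incidence_graph_def by (simp_all add: subspaces3_eq[OF finite_space3_axioms])
  show "card (verts1 G) = q\<^sup>2 + q + 1" "card (verts2 G) = q\<^sup>2 + q + 1"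
    unfolding G by (rule card_points, rule card_lines)
  \<comment> \<open>This is what \<open>class_le\<close> amounts to, as each class has q^2 + q + 1
    elements.\<close>
  have q3: "q + 1 \<le> q\<^sup>2" using q_ge_2 mult_le_mono1[of 2 q q] unfolding power2_eq_square by linarith
  have cls: "card {w \<in> subs 1 <+> subs 2. isl w = k} = q\<^sup>2 + q + 1" for k
  proof (cases k)
    case True
    have "{w \<in> subs 1 <+> subs 2. isl w = k} = Inl ` subs 1" using True by auto
    then show ?thesis by (simp only: card_image[OF inj_Inl] card_points)
  next
    case False
    have "{w \<in> subs 1 <+> subs 2. isl w = k} = Inr ` subs 2" using False by auto
    then show ?thesis by (simp only: card_image[OF inj_Inr] card_lines)
  qed
  have deg: "card {u. incident G w u} = q + 1" if "w \<in> subs 1 <+> subs 2" for w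
  proof -
    from that consider p where "p \<in> subs 1" "w = Inl p" | l where "l \<in> subs 2" "w = Inr l" by blast
    then show ?thesis
    proof cases
      case 1
      have "{u. incident G w u} = Inr ` {l \<in> subs 2. p \<subseteq> l}"
        using 1 by (auto simp: incident_def G)
      then show ?thesis using lines_on_point[OF 1(1)] by (simp add: card_image)
    next
      case 2
      have "{u. incident G w u} = Inl ` {p \<in> subs 1. p \<subseteq> l}"
        using 2 by (auto simp: incident_def G)
      then show ?thesis using points_on_line[OF 2(1)] by (simp add: card_image)
    qed
  qed
  \<comment> \<open>One statement for both dual cases of \<open>common_unique\<close>: distinct
    lines share only one point, and distinct points lie on only one common line.\<close>
  have two: "p = p'" if "p \<in> subs 1" "p' \<in> subs 1" "l \<in> subs 2" "l' \<in> subs 2" "l \<noteq> l'"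
    "p \<subseteq> l" "p \<subseteq> l'" "p' \<subseteq> l" "p' \<subseteq> l'" for p p' l l'
  proof -
    have "l \<inter> l' \<in> subs 1" by (rule meet_lines) (use that in auto)
    then show ?thesis using subs_eqI[of p 1 "l \<inter> l'"] subs_eqI[of p' 1 "l \<inter> l'"] that by auto
  qed
  show "incidence_plane (verts1 G <+> verts2 G) isl (incident G) q"
    unfolding G(1,2)
  proof
    show "finite (subs 1 <+> subs 2)" using finite_subs by simp
    show "2 \<le> q" by (rule q_ge_2)
    show "card {w \<in> subs 1 <+> subs 2. isl w = k} \<le> 2 * q\<^sup>2" for k using q3 unfolding cls by simp
    show "q\<^sup>2 \<le> card {w \<in> subs 1 <+> subs 2. isl w = k}" for k unfolding cls by simp
    show "card {u. incident G w u} \<le> 2 * q" if "w \<in> subs 1 <+> subs 2" for w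
      using q_ge_2 unfolding deg[OF that] by simp
    show "q \<le> card {u. incident G w u}" if "w \<in> subs 1 <+> subs 2" for w
      unfolding deg[OF that] by simp
    fix a b :: "(nat \<Rightarrow> 'a) set + (nat \<Rightarrow> 'a) set"
    show "incident G a b \<Longrightarrow> incident G b a" by (auto simp: incident_def)
    show "incident G a b \<Longrightarrow> a \<in> subs 1 <+> subs 2" by (auto simp: incident_def G)
    show "incident G a b \<Longrightarrow> isl a \<noteq> isl b" by (auto simp: incident_def)
    show "u = v" if "a \<noteq> b" "incident G a u" "incident G b u" "incident G a v" "incident G b v" for u v
      using that two unfolding incident_def G by (elim exE conjE disjE) auto
    assume ab: "a \<in> subs 1 <+> subs 2" "b \<in> subs 1 <+> subs 2" "isl a = isl b"
    then consider p p' where "p \<in> subs 1" "p' \<in> subs 1" "a = Inl p" "b = Inl p'"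
      | l l' where "l \<in> subs 2" "l' \<in> subs 2" "a = Inr l" "b = Inr l'" by auto
    then show "\<exists>u. incident G a u \<and> incident G b u"
    proof cases
      case 1
      show ?thesis
      proof (cases "p = p'")
        case True
        have "{l \<in> subs 2. p \<subseteq> l} \<noteq> {}" using lines_on_point[OF 1(1)] by (metis card.empty add_is_0 one_neq_zero)
        then obtain l where "l \<in> subs 2" "p \<subseteq> l" by blast
        then show ?thesis using 1 True by (intro exI[of _ "Inr l"]) (simp add: G)
      next
        case False
        obtain l where "l \<in> subs 2" "p \<subseteq> l" "p' \<subseteq> l" using join_points[OF 1(1,2) False] by blast
        then show ?thesis using 1 by (intro exI[of _ "Inr l"]) (simp add: G)
      qed
    next
      case 2
      show ?thesis
      proof (cases "l = l'")
        case True
        have "{p \<in> subs 1. p \<subseteq> l} \<noteq> {}" using points_on_line[OF 2(1)] by (metis card.empty add_is_0 one_neq_zero)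
        then obtain p where "p \<in> subs 1" "p \<subseteq> l" by blast
        then show ?thesis using 2 True by (intro exI[of _ "Inl p"]) (simp add: G)
      next
        case False
        have "l \<inter> l' \<in> subs 1" by (rule meet_lines[OF 2(1,2) False])
        then show ?thesis using 2 by (intro exI[of _ "Inl (l \<inter> l')"]) (simp add: G)
      qed
    qed
  qed
qed

section \<open>Logarithmic limits\<close>

text \<open>A bipartite graph is moved to the disjoint sum of its vertex types, with
  \<open>isl\<close> as colouring and edges directed from the first class to the second, so that it
  becomes a \<open>coloured_graph\<close>.\<close>

definition sum_edges :: "('c, 'd) bigraph \<Rightarrow> (('c + 'd) \<times> ('c + 'd)) set" where
  "sum_edges H = map_prod Inl Inr ` edges H"

definition sum_verts :: "('c, 'd) bigraph \<Rightarrow> ('c + 'd) set" where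
  "sum_verts H = verts1 H <+> verts2 H"

lemma sum_verts_simps [simp]:
  "Inl u \<in> sum_verts H \<longleftrightarrow> u \<in> verts1 H" "Inr v \<in> sum_verts H \<longleftrightarrow> v \<in> verts2 H"
  by (auto simp: sum_verts_def)

lemma coloured_graph_sum_edges: "coloured_graph (sum_edges H) isl"
  by unfold_locales (auto simp: sum_edges_def)

lemma hom_count_eq_card_maps:
  assumes H: "H \<in> bigraphs"
  shows "hom_count H G = card (colour_maps (sum_edges H) isl (sum_verts H) (sum_verts G) isl (incident G))"
proof -
  let ?M = "colour_maps (sum_edges H) isl (sum_verts H) (sum_verts G) isl (incident G)"
  let ?h = "\<lambda>(f, g). restrict (case_sum (Inl \<circ> f) (Inr \<circ> g)) (sum_verts H)"
  have "bij_betw ?h (homs H G) ?M"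
  proof (rule bij_betw_imageI)
    show "inj_on ?h (homs H G)"
    proof (rule inj_onI, clarify)
      fix f g f' g' assume a: "(f, g) \<in> homs H G" "(f', g') \<in> homs H G"
        "restrict (case_sum (Inl \<circ> f) (Inr \<circ> g)) (sum_verts H) = restrict (case_sum (Inl \<circ> f') (Inr \<circ> g')) (sum_verts H)"
      have "f u = f' u" if "u \<in> verts1 H" for u
        using fun_cong[OF a(3), of "Inl u"] that by simp
      moreover have "g v = g' v" if "v \<in> verts2 H" for v
        using fun_cong[OF a(3), of "Inr v"] that by simp
      ultimately show "f = f' \<and> g = g'"
        using a(1,2) unfolding homs_def
        by (intro conjI extensionalityI[of f "verts1 H" f'] extensionalityI[of g "verts2 H" g'])
          (auto simp: PiE_iff)
    qed
    show "?h ` homs H G = ?M"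
    proof
      show "?h ` homs H G \<subseteq> ?M"
      proof (rule image_subsetI, clarify)
        fix f g assume fg: "(f, g) \<in> homs H G"
        let ?\<phi> = "restrict (case_sum (Inl \<circ> f) (Inr \<circ> g)) (sum_verts H)"
        have "?\<phi> w \<in> sum_verts G \<and> isl (?\<phi> w) = isl w" if "w \<in> sum_verts H" for w
          using that fg by (cases w) (auto simp: homs_def)
        moreover have "incident G (?\<phi> a) (?\<phi> b)"
          if "(a, b) \<in> sum_edges H" "a \<in> sum_verts H" "b \<in> sum_verts H" for a b
          using that fg by (auto simp: homs_def sum_edges_def)
        moreover have "?\<phi> \<in> extensional (sum_verts H)" by (rule restrict_extensional)
        ultimately show "?\<phi> \<in> ?M" unfolding colour_maps_def PiE_iff by blast
      qed
      show "?M \<subseteq> ?h ` homs H G"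
      proof
        fix \<phi> assume \<phi>: "\<phi> \<in> ?M"
        define f where "f = (\<lambda>u \<in> verts1 H. projl (\<phi> (Inl u)))"
        define g where "g = (\<lambda>v \<in> verts2 H. projr (\<phi> (Inr v)))"
        have f: "\<phi> (Inl u) = Inl (f u)" "f u \<in> verts1 G" if "u \<in> verts1 H" for u
        proof -
          have "Inl u \<in> sum_verts H" using that by simp
          then have "\<phi> (Inl u) \<in> sum_verts G" "isl (\<phi> (Inl u))" using \<phi> by (auto simp: colour_maps_def)
          then show "\<phi> (Inl u) = Inl (f u)" "f u \<in> verts1 G"
            using that by (auto simp: f_def sum_verts_def isl_def)
        qed
        have g: "\<phi> (Inr v) = Inr (g v)" "g v \<in> verts2 G" if "v \<in> verts2 H" for v
        proof -
          have "Inr v \<in> sum_verts H" using that by simp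
          then have "\<phi> (Inr v) \<in> sum_verts G" "\<not> isl (\<phi> (Inr v))" using \<phi> by (auto simp: colour_maps_def)
          then show "\<phi> (Inr v) = Inr (g v)" "g v \<in> verts2 G"
            using that by (auto simp: g_def sum_verts_def isl_def)
        qed
        show "\<phi> \<in> ?h ` homs H G"
        proof (rule image_eqI[of _ _ "(f, g)"])
          have "(f u, g v) \<in> edges G" if uv: "(u, v) \<in> edges H" "u \<in> verts1 H" "v \<in> verts2 H" for u v
          proof -
            have "(Inl u, Inr v) \<in> sum_edges H" using uv(1) by (force simp: sum_edges_def)
            then have "incident G (\<phi> (Inl u)) (\<phi> (Inr v))"
              using \<phi> uv(2,3) by (simp add: colour_maps_def)
            then show ?thesis using f(1) g(1) uv(2,3) by simp
          qed
          then show "(f, g) \<in> homs H G"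
            using f(2) g(2) H by (auto simp: homs_def bigraphs_def f_def g_def)
          have "\<phi> \<in> extensional (sum_verts H)" using \<phi> by (simp add: colour_maps_def PiE_iff)
          moreover have "\<phi> w = case_sum (Inl \<circ> f) (Inr \<circ> g) w" if "w \<in> sum_verts H" for w
            using that f(1) g(1) by (cases w) simp_all
          ultimately show "\<phi> = ?h (f, g)"
            by (simp add: extensionalityI[of _ "sum_verts H"])
        qed
      qed
    qed
  qed
  then show ?thesis unfolding hom_count_def by (rule bij_betw_same_card)
qed

section \<open>Collapses, self-maps and the weight R\<close>

lemma exponent_case_sum:
  assumes H: "H \<in> bigraphs"
    and \<pi>: "\<And>u. u \<in> verts1 H \<Longrightarrow> \<pi> (Inl u) = Inl (f u)" "\<And>v. v \<in> verts2 H \<Longrightarrow> \<pi> (Inr v) = Inr (g v)"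
  shows "coloured_graph.exponent (sum_edges H) (sum_verts H) \<pi> =
    2 * (int (card (f ` verts1 H)) + int (card (g ` verts2 H))) - int (card (map_prod f g ` edges H))"
proof -
  interpret coloured_graph "sum_edges H" isl by (rule coloured_graph_sum_edges)
  have fin: "finite (verts1 H)" "finite (verts2 H)" and sub: "edges H \<subseteq> verts1 H \<times> verts2 H"
    using H by (auto simp: bigraphs_def)
  have "\<pi> ` sum_verts H = (f ` verts1 H) <+> (g ` verts2 H)"
  proof -
    have "\<pi> ` Inl ` verts1 H = Inl ` f ` verts1 H" "\<pi> ` Inr ` verts2 H = Inr ` g ` verts2 H"
      unfolding image_image using \<pi> by (auto intro!: image_cong)
    then show ?thesis by (simp add: sum_verts_def Plus_def image_Un)
  qed
  then have "card (\<pi> ` sum_verts H) = card (f ` verts1 H) + card (g ` verts2 H)"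
    using fin by (simp add: card_Plus)
  moreover have "map_prod \<pi> \<pi> ` (sum_edges H \<inter> sum_verts H \<times> sum_verts H)
      = map_prod Inl Inr ` map_prod f g ` edges H"
  proof -
    have "sum_edges H \<inter> sum_verts H \<times> sum_verts H = sum_edges H"
      using sub by (auto simp: sum_edges_def sum_verts_def)
    then have "map_prod \<pi> \<pi> ` (sum_edges H \<inter> sum_verts H \<times> sum_verts H) = map_prod \<pi> \<pi> ` sum_edges H"
      by (rule arg_cong)
    also have "\<dots> = map_prod Inl Inr ` map_prod f g ` edges H"
      unfolding sum_edges_def image_image by (rule image_cong) (use sub \<pi> in auto)
    finally show ?thesis .
  qed
  moreover have "card (map_prod Inl Inr ` map_prod f g ` edges H) = card (map_prod f g ` edges H)"
    by (rule card_image) (auto simp: inj_on_def)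
  ultimately show ?thesis unfolding exponent_def by simp
qed

text \<open>For \<beta> = 3/4 and \<alpha> = 1/2 both coefficients equal 2, so the weight is 2
  |V(H)| minus the quantity 2 |V(H')| - |E(H')|.\<close>

lemma collapse_weight_eq:
  "collapse_weight (3 / 4) (1 / 2) H H' = real (card (edges H'))
     + 2 * (real (card (verts1 H)) - real (card (verts1 H')))
     + 2 * (real (card (verts2 H)) - real (card (verts2 H')))"
  by (simp add: collapse_weight_def)

text \<open>Collapses and colour-preserving self-maps realise each other with matching weights, so a
  collapse of minimal weight corresponds to a self-map of maximal exponent.\<close>

lemma R_lim_eq_exponent:
  assumes H: "H \<in> bigraphs"
  shows "\<exists>\<pi> \<in> coloured_graph.self_maps isl (sum_verts H).
     (\<forall>\<rho> \<in> coloured_graph.self_maps isl (sum_verts H). coloured_graph.exponent (sum_edges H) (sum_verts H) \<rho>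
         \<le> coloured_graph.exponent (sum_edges H) (sum_verts H) \<pi>) \<and>
     R_lim (3 / 4) (1 / 2) H = 2 * (real (card (verts1 H)) + real (card (verts2 H)))
         - real_of_int (coloured_graph.exponent (sum_edges H) (sum_verts H) \<pi>)"
proof -
  interpret coloured_graph "sum_edges H" isl by (rule coloured_graph_sum_edges)
  let ?V = "sum_verts H"
  let ?w = "\<lambda>\<pi>. 2 * (real (card (verts1 H)) + real (card (verts2 H))) - real_of_int (exponent ?V \<pi>)"
  let ?c = "collapse_weight (3 / 4) (1 / 2) H"
  have fin: "finite (verts1 H)" "finite (verts2 H)" and sub: "edges H \<subseteq> verts1 H \<times> verts2 H"
    using H by (auto simp: bigraphs_def)
  have collapse_of: "\<exists>H' \<in> collapses H. ?c H' = ?w \<pi>" if \<pi>: "\<pi> \<in> self_maps ?V" for \<pi>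
  proof -
    define f where "f = (\<lambda>u \<in> verts1 H. projl (\<pi> (Inl u)))"
    define g where "g = (\<lambda>v \<in> verts2 H. projr (\<pi> (Inr v)))"
    have f: "\<pi> (Inl u) = Inl (f u)" if "u \<in> verts1 H" for u
    proof -
      have "isl (\<pi> (Inl u))" using \<pi> that by (simp add: self_maps_def)
      then show ?thesis using that by (simp add: f_def)
    qed
    have g: "\<pi> (Inr v) = Inr (g v)" if "v \<in> verts2 H" for v
    proof -
      have "\<not> isl (\<pi> (Inr v))" using \<pi> that by (simp add: self_maps_def)
      then show ?thesis using that by (simp add: g_def)
    qed
    define H' where "H' = Bigraph (f ` verts1 H) (g ` verts2 H) (map_prod f g ` edges H)"
    have "H' \<in> bigraphs" using fin sub by (auto simp: bigraphs_def H'_def)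
    moreover have "(f u, g v) \<in> map_prod f g ` edges H" if "(u, v) \<in> edges H" for u v
      by (rule image_eqI[OF _ that]) simp
    then have "(f, g) \<in> homs H H'"
      by (auto simp: homs_def H'_def PiE_iff) (simp_all add: f_def g_def)
    ultimately have "H' \<in> collapses H"
      unfolding collapses_def by (auto simp: H'_def)
    moreover have "exponent ?V \<pi> = 2 * (int (card (f ` verts1 H)) + int (card (g ` verts2 H)))
        - int (card (map_prod f g ` edges H))"
      using f g by (rule exponent_case_sum[OF H])
    then have "?c H' = ?w \<pi>"
      unfolding collapse_weight_eq by (simp add: H'_def)
    ultimately show ?thesis by blast
  qed
  have ret_of: "\<exists>\<pi> \<in> self_maps ?V. ?c H' = ?w \<pi>" if H': "H' \<in> collapses H" for H'
  proof -
    obtain f g where fg: "f ` verts1 H = verts1 H'" "g ` verts2 H = verts2 H'"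
      "map_prod f g ` edges H = edges H'"
      using H' by (auto simp: collapses_def)
    \<comment> \<open>Choosing a preimage in \<open>H\<close> for each vertex of the collapse turns
      it into a self-map. The choice is injective, so all cardinalities are preserved.\<close>
    define f' where "f' = inv_into (verts1 H) f \<circ> f"
    define g' where "g' = inv_into (verts2 H) g \<circ> g"
    have f'V: "f' u \<in> verts1 H" if "u \<in> verts1 H" for u
      unfolding f'_def comp_def by (rule inv_into_into) (use that in blast)
    have g'V: "g' v \<in> verts2 H" if "v \<in> verts2 H" for v
      unfolding g'_def comp_def by (rule inv_into_into) (use that in blast)
    define \<pi> where "\<pi> = restrict (case_sum (Inl \<circ> f') (Inr \<circ> g')) ?V"
    have "\<pi> \<in> self_maps ?V" using f'V g'V by (auto simp: self_maps_def \<pi>_def sum_verts_def)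
    have \<pi>: "\<pi> (Inl u) = Inl (f' u)" if "u \<in> verts1 H" for u using that by (simp add: \<pi>_def)
    have \<pi>': "\<pi> (Inr u) = Inr (g' u)" if "u \<in> verts2 H" for u using that by (simp add: \<pi>_def)
    have injf: "inj_on (inv_into (verts1 H) f) (f ` verts1 H)" by (rule inj_on_inv_into) simp
    have injg: "inj_on (inv_into (verts2 H) g) (g ` verts2 H)" by (rule inj_on_inv_into) simp
    have "card (f' ` verts1 H) = card (verts1 H')"
      using card_image[OF injf] unfolding f'_def image_comp[symmetric] fg .
    moreover have "card (g' ` verts2 H) = card (verts2 H')"
      using card_image[OF injg] unfolding g'_def image_comp[symmetric] fg .
    moreover have "card (map_prod f' g' ` edges H) = card (edges H')"
    proof -
      have "map_prod f' g' ` edges H = map_prod (inv_into (verts1 H) f) (inv_into (verts2 H) g) ` edges H'"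
        unfolding fg(3)[symmetric] image_image by (intro image_cong) (auto simp: f'_def g'_def)
      moreover have "inj_on (map_prod (inv_into (verts1 H) f) (inv_into (verts2 H) g)) (edges H')"
        by (rule inj_on_subset[OF map_prod_inj_on[OF injf injg]]) (use sub fg(3) in force)
      ultimately show ?thesis by (simp add: card_image)
    qed
    moreover have "exponent ?V \<pi> = 2 * (int (card (f' ` verts1 H)) + int (card (g' ` verts2 H)))
        - int (card (map_prod f' g' ` edges H))"
      using \<pi> \<pi>' by (rule exponent_case_sum[OF H])
    ultimately have "?c H' = ?w \<pi>"
      unfolding collapse_weight_eq by simp
    then show ?thesis using \<open>\<pi> \<in> self_maps ?V\<close> by blast
  qed
  have "R_lim (3 / 4) (1 / 2) H \<in> ?c ` collapses H"
    unfolding R_lim_def using finite_collapse_weights[OF H] self_in_collapses[OF H] by (intro Min_in) auto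
  then obtain H' where H': "H' \<in> collapses H" "R_lim (3 / 4) (1 / 2) H = ?c H'" by blast
  obtain \<pi> where \<pi>: "\<pi> \<in> self_maps ?V" "?c H' = ?w \<pi>" using ret_of[OF H'(1)] by blast
  have "exponent ?V \<rho> \<le> exponent ?V \<pi>" if \<rho>: "\<rho> \<in> self_maps ?V" for \<rho>
  proof -
    obtain H'' where H'': "H'' \<in> collapses H" "?c H'' = ?w \<rho>" using collapse_of[OF \<rho>] by blast
    have "R_lim (3 / 4) (1 / 2) H \<le> ?c H''"
      unfolding R_lim_def using finite_collapse_weights[OF H] H''(1) by (intro Min_le) auto
    then show ?thesis using H'(2) \<pi>(2) H''(2) by simp
  qed
  then show ?thesis using \<pi> H'(2) by (intro bexI[of _ \<pi>]) auto
qed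

text \<open>A collapse keeps at least one edge and has no more vertices than \<open>H\<close>. The
  bound makes the limits usable as denominators.\<close>

lemma R_lim_ge_1:
  assumes H: "H \<in> bigraphs0"
  shows "1 \<le> R_lim (3 / 4) (1 / 2) H"
proof -
  let ?c = "collapse_weight (3 / 4) (1 / 2) H"
  have HB: "H \<in> bigraphs" "edges H \<noteq> {}" using H by (auto simp: bigraphs0_def)
  have fin: "finite (verts1 H)" "finite (verts2 H)" "finite (edges H)"
    using HB(1) by (auto simp: bigraphs_def intro: finite_subset)
  have "1 \<le> ?c H'" if H': "H' \<in> collapses H" for H'
  proof -
    obtain f g where fg: "f ` verts1 H = verts1 H'" "g ` verts2 H = verts2 H'"
      "map_prod f g ` edges H = edges H'"
      using H' by (auto simp: collapses_def)
    have "card (verts1 H') \<le> card (verts1 H)" "card (verts2 H') \<le> card (verts2 H)"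
      using fin by (simp_all add: card_image_le flip: fg)
    moreover have "edges H' \<noteq> {}" "finite (edges H')" unfolding fg(3)[symmetric] using HB(2) fin(3) by auto
    then have "1 \<le> card (edges H')" by (simp add: Suc_le_eq card_gt_0_iff)
    ultimately show ?thesis unfolding collapse_weight_eq by simp
  qed
  then show ?thesis
    unfolding R_lim_def using finite_collapse_weights[OF HB(1)] self_in_collapses[OF HB(1)]
    by (subst Min_ge_iff) auto
qed

lemma K2_bigraphs0: "K2 \<in> bigraphs0"
  by (simp add: K2_def bigraphs0_def bigraphs_def)

lemma R_lim_K2: "R_lim (3 / 4) (1 / 2) K2 = 1"
proof (rule antisym)
  have K: "K2 \<in> bigraphs" using K2_bigraphs0 by (simp add: bigraphs0_def)
  have "R_lim (3 / 4) (1 / 2) K2 \<le> collapse_weight (3 / 4) (1 / 2) K2 K2"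
    unfolding R_lim_def using finite_collapse_weights[OF K] self_in_collapses[OF K] by (intro Min_le) auto
  also have "\<dots> = 1" by (simp add: collapse_weight_def K2_def)
  finally show "R_lim (3 / 4) (1 / 2) K2 \<le> 1" .
qed (rule R_lim_ge_1[OF K2_bigraphs0])

section \<open>Passage to the limit\<close>

text \<open>The number of homomorphisms lies between q^m and C q^m, and both classes have about q^2
  vertices. Divided by ln q, the logarithm of the density therefore tends to 2 |V(H)| - m up to
  sign, which is R by \<open>R_lim_eq_exponent\<close>.\<close>

lemma tendsto_log_t_B:
  fixes G :: "nat \<Rightarrow> ('p, 'l) bigraph" and r :: "nat \<Rightarrow> nat" and H :: "('c, 'd) bigraph"
  assumes plane: "\<And>n. incidence_plane (sum_verts (G n)) isl (incident (G n)) (r n)"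
    and card: "\<And>n. card (verts1 (G n)) = (r n)\<^sup>2 + r n + 1" "\<And>n. card (verts2 (G n)) = (r n)\<^sup>2 + r n + 1"
    and r: "filterlim r at_top sequentially"
    and H: "H \<in> bigraphs0"
  shows "(\<lambda>n. - ln (t_B H (G n)) / ln (real (r n))) \<longlonglongrightarrow> R_lim (3 / 4) (1 / 2) H"
proof -
  interpret coloured_graph "sum_edges H" isl by (rule coloured_graph_sum_edges)
  have HB: "H \<in> bigraphs" and ne: "edges H \<noteq> {}" using H by (auto simp: bigraphs0_def)
  let ?V = "sum_verts H"
  have V: "finite ?V" "?V \<noteq> {}"
    using HB ne by (auto simp: sum_verts_def bigraphs_def)
  obtain \<pi> where \<pi>: "\<pi> \<in> self_maps ?V" and max: "\<And>\<rho>. \<rho> \<in> self_maps ?V \<Longrightarrow> exponent ?V \<rho> \<le> exponent ?V \<pi>"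
    and R: "R_lim (3 / 4) (1 / 2) H = 2 * (real (card (verts1 H)) + real (card (verts2 H)))
         - real_of_int (exponent ?V \<pi>)"
    using R_lim_eq_exponent[OF HB] by blast
  define m where "m = exponent ?V \<pi>"
  define k where "k = card (verts1 H) + card (verts2 H)"
  have "\<exists>C. \<forall>(W :: ('p + 'l) set) c I q. incidence_plane W c I q \<longrightarrow>
     real (card (colour_maps (sum_edges H) isl ?V W c I)) \<le> real C * real q powi m"
    unfolding m_def by (rule maps_upper_bound[OF V max])
  then obtain C where C: "\<And>n. real (hom_count H (G n)) \<le> real C * real (r n) powi m"
    unfolding hom_count_eq_card_maps[OF HB] using plane by blast
  have low: "real (r n) powi m \<le> real (hom_count H (G n))" for n
    unfolding hom_count_eq_card_maps[OF HB] m_def by (rule maps_lower_bound[OF plane V(1) \<pi> max])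
  have r2: "2 \<le> r n" for n using incidence_plane.q_ge_2[OF plane] .
  have rp: "0 < real (r n) powi m" for n using r2[of n] by (intro zero_less_power_int) simp
  \<comment> \<open>The lower and upper bound enclose the same positive power, which forces C > 0;
    the logarithm of the upper bound can then be split.\<close>
  have C0: "0 < real C"
    using less_le_trans[OF rp order_trans[OF low C], of 0] rp[of 0] by (simp add: zero_less_mult_iff)
  define N where "N n = real ((r n)\<^sup>2 + r n + 1)" for n
  define D where "D n = ln (real (hom_count H (G n)))" for n
  have hp: "0 < real (hom_count H (G n))" for n by (rule less_le_trans[OF rp low])
  have t: "- ln (t_B H (G n)) = real k * ln (N n) - D n" for n
  proof -
    have "t_B H (G n) = real (hom_count H (G n)) / N n ^ k"
      unfolding t_B_def card N_def k_def power_add ..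
    moreover have "0 < N n" by (simp add: N_def add_pos_nonneg)
    ultimately show ?thesis using hp[of n] by (simp add: ln_div ln_realpow D_def)
  qed
  have lnr: "0 < ln (real (r n))" for n using r2[of n] by (intro ln_gt_zero) simp
  have ln_powi: "ln (real (r n) powi m) = real_of_int m * ln (real (r n))" for n
    using r2[of n] by (simp add: powr_real_of_int' [symmetric] ln_powr)
  have Dl: "real_of_int m * ln (real (r n)) \<le> D n" for n
    unfolding D_def using low[of n] rp[of n] hp[of n] r2[of n]
    unfolding ln_powi[symmetric] by (simp add: ln_le_cancel_iff)
  have Du: "D n \<le> ln C + real_of_int m * ln (real (r n))" for n
  proof -
    have "D n \<le> ln (real C * real (r n) powi m)"
      unfolding D_def using C[of n] hp[of n] by (meson ln_mono less_le_trans)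
    also have "\<dots> = ln C + real_of_int m * ln (real (r n))"
      using C0 rp[of n] r2[of n] by (simp add: ln_mult ln_powi)
    finally show ?thesis .
  qed
  have "((\<lambda>x. ln (real C) / ln (real x)) \<longlongrightarrow> 0) at_top" by real_asymp
  then have "(\<lambda>n. ln (real C) / ln (real (r n))) \<longlonglongrightarrow> 0" by (rule filterlim_compose[OF _ r])
  from tendsto_add[OF this tendsto_const[of "real_of_int m"]]
  have up: "(\<lambda>n. ln (real C) / ln (real (r n)) + real_of_int m) \<longlonglongrightarrow> real_of_int m" by simp
  have D: "(\<lambda>n. D n / ln (real (r n))) \<longlonglongrightarrow> real_of_int m"
  proof (rule tendsto_sandwich[OF _ _ tendsto_const up])
    have "real_of_int m \<le> D n / ln (real (r n))" for n
      using Dl[of n] lnr[of n] by (simp add: pos_le_divide_eq)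
    then show "\<forall>\<^sub>F n in sequentially. real_of_int m \<le> D n / ln (real (r n))" by simp
    have "D n / ln (real (r n)) \<le> ln (real C) / ln (real (r n)) + real_of_int m" for n
    proof -
      have "D n / ln (real (r n)) \<le> (ln (real C) + real_of_int m * ln (real (r n))) / ln (real (r n))"
        using Du[of n] lnr[of n] by (intro divide_right_mono) auto
      then show ?thesis using lnr[of n] by (simp add: add_divide_distrib)
    qed
    then show "\<forall>\<^sub>F n in sequentially. D n / ln (real (r n)) \<le> ln (real C) / ln (real (r n)) + real_of_int m"
      by simp
  qed
  have "((\<lambda>x. ln (real (x\<^sup>2 + x + 1)) / ln (real x)) \<longlongrightarrow> 2) at_top"
    by simp real_asymp
  then have "(\<lambda>n. ln (N n) / ln (real (r n))) \<longlonglongrightarrow> 2"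
    unfolding N_def by (rule filterlim_compose[OF _ r])
  then have "(\<lambda>n. real k * (ln (N n) / ln (real (r n))) - D n / ln (real (r n))) \<longlonglongrightarrow> real k * 2 - real_of_int m"
    by (intro tendsto_intros D)
  moreover have "real k * 2 - real_of_int m = R_lim (3 / 4) (1 / 2) H"
    unfolding R k_def m_def by simp
  moreover have "real k * (ln (N n) / ln (real (r n))) - D n / ln (real (r n)) = - ln (t_B H (G n)) / ln (real (r n))" for n
    unfolding t by (simp add: diff_divide_distrib)
  ultimately show ?thesis by simp
qed

text \<open>Both logarithms are normalised by the same ln q, which cancels in the quotient.\<close>

lemma tendsto_log_ratio:
  fixes G :: "nat \<Rightarrow> ('p, 'l) bigraph" and r :: "nat \<Rightarrow> nat"
    and H1 :: "('a, 'b) bigraph" and H2 :: "('c, 'd) bigraph"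
  assumes plane: "\<And>n. incidence_plane (sum_verts (G n)) isl (incident (G n)) (r n)"
    and card: "\<And>n. card (verts1 (G n)) = (r n)\<^sup>2 + r n + 1" "\<And>n. card (verts2 (G n)) = (r n)\<^sup>2 + r n + 1"
    and r: "filterlim r at_top sequentially"
    and H: "H1 \<in> bigraphs0" "H2 \<in> bigraphs0"
  shows "(\<lambda>n. (- ln (t_B H1 (G n))) / (- ln (t_B H2 (G n))))
    \<longlonglongrightarrow> R_lim (3 / 4) (1 / 2) H1 / R_lim (3 / 4) (1 / 2) H2"
proof -
  have "ln (real (r n)) \<noteq> 0" for n
    using incidence_plane.q_ge_2[OF plane, of n] by simp
  moreover have "(\<lambda>n. (- ln (t_B H1 (G n)) / ln (real (r n))) / (- ln (t_B H2 (G n)) / ln (real (r n))))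
      \<longlonglongrightarrow> R_lim (3 / 4) (1 / 2) H1 / R_lim (3 / 4) (1 / 2) H2"
    using R_lim_ge_1[OF H(2)]
    by (intro tendsto_divide tendsto_log_t_B[OF plane card r] H) auto
  ultimately show ?thesis by simp
qed

text \<open>A degree of at most 2 q is less than the class size q^2 + q + 1. Hence the convention
  for complete bipartite graphs never applies to the planes.\<close>

lemma not_complete_bipartite:
  assumes "incidence_plane (sum_verts G) isl (incident G) q"
    and "card (verts1 G) = q\<^sup>2 + q + 1" "card (verts2 G) = q\<^sup>2 + q + 1"
  shows "\<not> complete_bipartite G"
proof
  interpret incidence_plane "sum_verts G" isl "incident G" q by fact
  assume c: "complete_bipartite G"
  obtain a where a: "a \<in> verts1 G" using assms(2) by (cases "verts1 G = {}") auto
  have "{u. incident G (Inl a) u} = Inr ` verts2 G"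
    using c a by (auto simp: complete_bipartite_def incident_def)
  then have "q\<^sup>2 + q + 1 \<le> 2 * q"
    using deg_le[of "Inl a"] a assms(3) by (simp add: card_image)
  moreover have "q \<le> q\<^sup>2" by (simp add: power2_eq_square)
  ultimately show False by simp
qed

lemma incidence_plane_bigraphs0:
  assumes "incidence_plane (sum_verts G) isl (incident G) q" "edges G \<subseteq> verts1 G \<times> verts2 G"
  shows "G \<in> bigraphs0"
proof -
  interpret incidence_plane "sum_verts G" isl "incident G" q by fact
  have "{w \<in> sum_verts G. isl w = True} \<noteq> {}" using class_ge[of True] q_pos by (metis card.empty le_zero_eq power_eq_0_iff less_not_refl)
  then obtain w where "w \<in> sum_verts G" by blast
  then obtain u where "incident G w u" using common_exists[of w w] by blast
  then have "edges G \<noteq> {}" by (auto simp: incident_def)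
  moreover have "finite (verts1 G)" "finite (verts2 G)"
    using finite_W by (auto simp: sum_verts_def Plus_def dest: finite_imageD)
  ultimately show ?thesis using assms(2) by (simp add: bigraphs0_def bigraphs_def)
qed

theorem theorem2:
  fixes F :: "nat \<Rightarrow> 'a ring"
  defines "Q \<equiv> {q :: nat. primepow q}"
  defines "G \<equiv> (\<lambda>q. incidence_graph (F q))"
  assumes "\<And>q. q \<in> Q \<Longrightarrow> field (F q) \<and> order (F q) = q"
  shows "log_convergent (\<lambda>n. G (enumerate Q n)) \<and>
    (\<forall>H \<in> (bigraphs0 :: ('c, 'd) bigraph set).
       (\<lambda>n. h_B H (G (enumerate Q n))) \<longlonglongrightarrow> R_lim (3 / 4) (1 / 2) H)"
proof -
  let ?r = "enumerate Q" and ?G = "\<lambda>n. G (enumerate Q n)"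
  have "{p :: nat. prime p} \<subseteq> Q" using primepow_prime by (auto simp: Q_def)
  then have inf: "infinite Q" using primes_infinite finite_subset by blast
  have rQ: "?r n \<in> Q" for n by (rule enumerate_in_set[OF inf])
  have r2: "2 \<le> ?r n" for n
    using primepow_gt_Suc_0[of "?r n"] rQ[of n] by (simp add: Q_def)
  \<comment> \<open>A strictly increasing sequence of natural numbers is unbounded, so the
    enumeration of the prime powers tends to infinity.\<close>
  have r: "filterlim ?r at_top sequentially"
    using strict_mono_enumerate[OF inf] by (rule filterlim_subseq)
  have plane: "incidence_plane (sum_verts (?G n)) isl (incident (?G n)) (?r n)"
    and card: "card (verts1 (?G n)) = (?r n)\<^sup>2 + ?r n + 1" "card (verts2 (?G n)) = (?r n)\<^sup>2 + ?r n + 1" for n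
    using incidence_plane_incidence_graph[of "F (?r n)" "?r n"] assms(3)[OF rQ] r2
    unfolding G_def sum_verts_def by auto
  have nc: "\<not> complete_bipartite (?G n)" for n by (rule not_complete_bipartite[OF plane card])
  note ratio = tendsto_log_ratio[of ?G ?r, OF plane card r]
  have "?G n \<in> bigraphs0" for n
    by (rule incidence_plane_bigraphs0[OF plane]) (auto simp: G_def incidence_graph_def)
  moreover have "convergent (\<lambda>n. log_ratio H1 H2 (?G n))"
    if "H1 \<in> bigraphs0" "H2 \<in> bigraphs0" for H1 H2 :: "(nat, nat) bigraph"
    using ratio[OF that] nc unfolding log_ratio_def convergent_def by auto
  \<comment> \<open>The special case of the ratio with denominator \<open>K2\<close>, whose own
    limit is 1 by \<open>R_lim_K2\<close>.\<close>
  moreover have "(\<lambda>n. h_B H (?G n)) \<longlonglongrightarrow> R_lim (3 / 4) (1 / 2) H"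
    if "H \<in> bigraphs0" for H :: "('c, 'd) bigraph"
    using ratio[OF that K2_bigraphs0] nc unfolding h_B_def R_lim_K2 by simp
  ultimately show ?thesis unfolding log_convergent_def by blast
qed

end
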